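(* Let $\mathbf{c} = (c_1, \dots, c_m)$ and $\mathbf{d} = (d_1, \dots, d_n)$ be IP sequences. Let $r \in [m]$, $s \in [n]$, $t \in [\min\{r,s\}]$, and let $u$ be a non-negative real number such that $u > \frac{6-t}{3}$. If $c_1 \geq t+u+1$, $d_1 \geq t+u+1$, $\mathcal{A} \subseteq \mathcal{S}_{\mathbf{c},r}$, $\mathcal{B} \subseteq \mathcal{S}_{\mathbf{d},s}$, and $\mathcal{A}$ and $\mathcal{B}$ are cross-$t$-intersecting, then \[|\mathcal{A}||\mathcal{B}| \leq \Bigg( \sum_{I \in \binom{[t+1,m]}{r-t}} \prod_{i \in I} c_i \Bigg) \Bigg( \sum_{J \in \binom{[t+1,n]}{s-t}}\prod_{j \in J} d_j \Bigg).\] Moreover, if $u > 0$, then the bound is attained if and only if for some $T \in \mathcal{S}_{\mathbf{c},t} \cap \mathcal{S}_{\mathbf{d},t}$ with $|\mathcal{S}_{\mathbf{c},r}(T)| = |\mathcal{S}_{\mathbf{c},r,t}|$ and $|\mathcal{S}_{\mathbf{d},s}(T)| = |\mathcal{S}_{\mathbf{d},s,t}|$, we have $\mathcal{A} = \mathcal{S}_{\mathbf{c},r}(T)$ and $\mathcal{B} = \mathcal{S}_{\mathbf{d},s}(T)$.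
   Context: For integers $a,b$, $[a,b]$ is the set of positive integers $i$ with $a \leq i \leq b$, and $[n]=[1,n]$. $\binom{X}{k}$ is the family of all $k$-element subsets of $X$ (an empty product equals $1$). An IP sequence is a finite sequence $(c_1,\dots,c_n)$ of positive integers with $c_1 \leq \dots \leq c_n$. For an IP sequence $\mathbf{c}=(c_1,\dots,c_n)$ and $r \in [n]$, $\mathcal{S}_{\mathbf{c},r}$ is the family of all sets $\{(x_1,y_{x_1}),\dots,(x_r,y_{x_r})\}$ of pairs such that $\{x_1,\dots,x_r\} \in \binom{[n]}{r}$ (so $x_1,\dots,x_r$ are distinct) and $y_{x_j} \in [c_{x_j}]$ for each $j \in [r]$. For a family $\mathcal{F}$ and a set $T$, $\mathcal{F}(T) = \{F \in \mathcal{F} : T \subseteq F\}$. For $t \in [r]$, $\mathcal{S}_{\mathbf{c},r,t} = \{A \in \mathcal{S}_{\mathbf{c},r} : (x,1) \in A \text{ for each } x \in [t]\}$. Families $\mathcal{A}$ and $\mathcal{B}$ (possibly empty) are cross-$t$-intersecting if $|A \cap B| \geq t$ for every $A \in \mathcal{A}$ and every $B \in \mathcal{B}$. *)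

theory Defs
  imports Complex_Main "HOL-Library.Ramsey"
begin

text \<open>A sequence of length \<open>n\<close> is a function on the naturals of which only the values at the
  indices \<open>1, \<dots>, n\<close> matter; every definition below inspects the function on \<open>{1..n}\<close> only.
  The family of all \<open>k\<close>-element subsets of \<open>X\<close> is \<open>nsets X k\<close>.\<close>

definition IP_sequence :: "nat \<Rightarrow> (nat \<Rightarrow> nat) \<Rightarrow> bool" where
  "IP_sequence n c \<longleftrightarrow> (\<forall>i\<in>{1..n}. 0 < c i) \<and> mono_on {1..n} c"

definition signed_sets :: "nat \<Rightarrow> (nat \<Rightarrow> nat) \<Rightarrow> nat \<Rightarrow> (nat \<times> nat) set set" where
  "signed_sets n c r =
     {(\<lambda>x. (x, y x)) ` X | X y. X \<in> nsets {1..n} r \<and> (\<forall>x\<in>X. y x \<in> {1..c x})}"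

definition signed_sets_fixed :: "nat \<Rightarrow> (nat \<Rightarrow> nat) \<Rightarrow> nat \<Rightarrow> nat \<Rightarrow> (nat \<times> nat) set set" where
  "signed_sets_fixed n c r t = {A \<in> signed_sets n c r. \<forall>x\<in>{1..t}. (x, 1) \<in> A}"

definition containing :: "'a set set \<Rightarrow> 'a set \<Rightarrow> 'a set set" where
  "containing F T = {A \<in> F. T \<subseteq> A}"

text \<open>The intended use is for families of finite sets: \<open>card\<close> of an infinite intersection is \<open>0\<close>.\<close>

definition cross_intersecting :: "nat \<Rightarrow> 'a set set \<Rightarrow> 'a set set \<Rightarrow> bool" where
  "cross_intersecting t \<A> \<B> \<longleftrightarrow> (\<forall>A\<in>\<A>. \<forall>B\<in>\<B>. t \<le> card (A \<inter> B))"

end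

theory Submission
  imports Defs "HOL-Library.FuncSet"
begin

text \<open>Put \<open>lam = t + u\<close>, so that every alphabet has at least \<open>lam + 1\<close> letters and
  \<open>3 (lam - 2) > 2 t\<close>. Replacing a pair \<open>(a, b)\<close> by \<open>(a, 1)\<close> wherever this
  creates no duplicate keeps two families cross-\<open>t\<close>-intersecting. When no such replacement changes
  the first family, already the sets of \<^emph>\<open>ones\<close>, \<open>{x. (x, 1) \<in> A}\<close>, of its
  members meet those of the second family in \<open>t\<close> points: at a common point that carries another
  letter, the first set may be changed to carry the letter \<open>1\<close> and the common point disappears.
  Counting signed sets by their set of ones therefore reduces the theorem to a weighted statement about
  families of subsets of \<open>{1..m}\<close> and \<open>{1..n}\<close>
  (\<open>weighted_cross_intersecting\<close>). The weights that arise do not decrease when an element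
  is replaced by a smaller one, and grow at least by the factor \<open>lam\<close> when an element is removed,
  because a one can be overwritten by at least \<open>lam\<close> other letters.

  For the weighted statement take a pair of families with maximal product of weights, shifted to the left.
  Let \<open>p\<close> be least such that members of the two families always share \<open>t\<close> elements of
  \<open>{1..p}\<close>. If \<open>p = t\<close>, all members contain \<open>{1..t}\<close>. Otherwise some
  \<^emph>\<open>critical\<close> pairs share exactly \<open>t\<close> elements of \<open>{1..p}\<close>, one of them
  being \<open>p\<close>; by shiftedness their union covers \<open>{1..p}\<close>, so that their sizes inside
  \<open>{1..p}\<close> add up to \<open>p + t\<close>. One may therefore adjoin \<open>A - {p}\<close> for the
  critical \<open>A\<close> of size \<open>i\<close> at the price of deleting the critical \<open>B\<close> of size
  \<open>j = p + t - i\<close>, and vice versa (\<open>alteration\<close>). Neither change may increase the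
  product, which forces the critical sets to carry a share of at least \<open>1 - 1/lam\<close> of both
  families. On the other hand shifting \<open>p\<close> downwards shows by double counting that this share is at most
  \<open>i/p\<close> and \<open>j/p\<close> (\<open>critical_share\<close>). Adding the two resulting
  inequalities gives \<open>p (lam - 2) \<le> t lam\<close>, hence \<open>p \<le> t + 2\<close>. The two
  remaining values of \<open>p\<close> leave so few possible traces on \<open>{1..p}\<close> that the families
  can be compared with the stars directly (\<open>product_bound_Suc\<close>,
  \<open>product_bound_Suc_Suc\<close>).

  For \<open>lam > t\<close> these comparisons are strict, so that only \<open>p = t\<close> remains for optimal
  shifted pairs, which are then a pair of stars. This description survives the passage back through each replacement
  (\<open>containing_uncompress\<close>): were a family only partly moved, there would be two members,
  one from each family, whose only common elements are the \<open>t - 1\<close> elements of the kernel that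
  the replacement does not touch.\<close>

section \<open>Compression and its reversal\<close>

text \<open>The replacement of \<open>j\<close> by \<open>i\<close> is carried out only where it makes sense. The same
  operation serves for natural numbers \<open>i < j\<close> and for pairs \<open>i = (a, 1)\<close>,
  \<open>j = (a, b)\<close>.\<close>

definition shift :: "'a \<Rightarrow> 'a \<Rightarrow> 'a set \<Rightarrow> 'a set" where
  "shift i j A = (if j \<in> A \<and> i \<notin> A then insert i (A - {j}) else A)"

definition move :: "'a \<Rightarrow> 'a \<Rightarrow> 'a set set \<Rightarrow> 'a set \<Rightarrow> 'a set" where
  "move i j \<A> A = (if shift i j A \<in> \<A> then A else shift i j A)"

definition compress :: "'a \<Rightarrow> 'a \<Rightarrow> 'a set set \<Rightarrow> 'a set set" where
  "compress i j \<A> = move i j \<A> ` \<A>"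

lemma move_cases:
  assumes "A \<in> \<A>"
  obtains (fixed) "move i j \<A> A = A" "shift i j A \<in> \<A>"
  | (moved) "j \<in> A" "i \<notin> A" "move i j \<A> A = insert i (A - {j})" "insert i (A - {j}) \<notin> \<A>"
proof (cases "shift i j A \<in> \<A>")
  case True
  then show thesis using fixed by (simp add: move_def)
next
  case False
  then have "j \<in> A \<and> i \<notin> A" using assms by (auto simp: shift_def split: if_splits)
  then show thesis using moved False by (simp add: move_def shift_def)
qed

text \<open>A set is replaced only if the result is not yet present, so two members cannot be sent to the same set.
  Hence compression preserves cardinalities.\<close>

lemma inj_on_move: "inj_on (move i j \<A>) \<A>"
proof (rule inj_onI)
  fix A B assume A: "A \<in> \<A>" and B: "B \<in> \<A>" and eq: "move i j \<A> A = move i j \<A> B"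
  show "A = B"
    using A
  proof (cases rule: move_cases[where i = i and j = j])
    case fixed
    show ?thesis using B by (cases rule: move_cases[where i = i and j = j]) (use fixed eq A in auto)
  next
    case moved
    show ?thesis using B
    proof (cases rule: move_cases[where i = i and j = j])
      case fixed
      then show ?thesis using moved eq B by auto
    next
      case m2: moved
      have "insert i (A - {j}) = insert i (B - {j})" using moved(3) m2(3) eq by simp
      then have "insert i (A - {j}) - {i} = insert i (B - {j}) - {i}" by simp
      then have "A - {j} = B - {j}" using moved(2) m2(2) by auto
      then show ?thesis using moved(1) m2(1) by blast
    qed
  qed
qed

lemma card_compress: "card (compress i j \<A>) = card \<A>"
  unfolding compress_def by (rule card_image[OF inj_on_move])

lemma compress_subset:
  assumes "\<A> \<subseteq> S" "\<And>A. A \<in> S \<Longrightarrow> shift i j A \<in> S"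
  shows "compress i j \<A> \<subseteq> S"
  using assms unfolding compress_def move_def by auto

lemma sum_compress_ge:
  fixes g :: "'a set \<Rightarrow> real"
  assumes "\<And>A. A \<in> \<A> \<Longrightarrow> g A \<le> g (shift i j A)"
  shows "sum g \<A> \<le> sum g (compress i j \<A>)"
proof -
  have "sum g (compress i j \<A>) = (\<Sum>A\<in>\<A>. g (move i j \<A> A))"
    unfolding compress_def using sum.reindex[OF inj_on_move, of g] by simp
  also have "\<dots> \<ge> sum g \<A>"
    by (rule sum_mono) (use assms in \<open>auto simp: move_def\<close>)
  finally show ?thesis .
qed

lemma card_shift_inter:
  assumes "finite A" "finite B" "i \<notin> A" "j \<in> A"
  shows "card (insert i (A - {j}) \<inter> insert i (B - {j})) \<ge> card (A \<inter> B)"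
proof -
  have "A \<inter> B \<subseteq> insert j ((insert i (A - {j}) \<inter> insert i (B - {j})) - {i})"
    using assms by blast
  then have "card (A \<inter> B) \<le> card (insert j ((insert i (A - {j}) \<inter> insert i (B - {j})) - {i}))"
    using assms by (intro card_mono) auto
  also have "\<dots> \<le> Suc (card ((insert i (A - {j}) \<inter> insert i (B - {j})) - {i}))"
    by (rule card_insert_le_m1) auto
  also have "\<dots> = card (insert i (A - {j}) \<inter> insert i (B - {j}))"
    using assms by (intro card_Suc_Diff1) auto
  finally show ?thesis .
qed

text \<open>The critical case of the preservation of intersections: \<open>A\<close> is moved and \<open>B\<close> is not.
  Removing \<open>j\<close> from \<open>A\<close> can only do harm if \<open>B\<close> contains \<open>j\<close> but not
  \<open>i\<close>; but then the shifted \<open>B\<close> is in the family too, and its intersection with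
  \<open>A\<close> does not use \<open>j\<close>.\<close>

lemma moved_fixed_inter:
  assumes "finite A" "finite B" "i \<notin> A" "j \<in> A" "t \<le> card (A \<inter> B)" "t \<le> card (A \<inter> shift i j B)"
  shows "t \<le> card (insert i (A - {j}) \<inter> B)"
proof (cases "j \<in> B \<and> i \<in> B")
  case True
  then have "insert i (A - {j}) \<inter> insert i (B - {j}) \<subseteq> insert i (A - {j}) \<inter> B" by auto
  then have "card (insert i (A - {j}) \<inter> insert i (B - {j})) \<le> card (insert i (A - {j}) \<inter> B)"
    using assms by (intro card_mono) auto
  then show ?thesis using card_shift_inter[of A B i j] assms by linarith
next
  case False
  show ?thesis
  proof (cases "j \<in> B")
    case True
    then have "i \<notin> B" using False by simp
    then have "A \<inter> shift i j B \<subseteq> insert i (A - {j}) \<inter> B"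
      using True assms by (auto simp: shift_def)
    then have "card (A \<inter> shift i j B) \<le> card (insert i (A - {j}) \<inter> B)"
      using assms by (intro card_mono) auto
    then show ?thesis using assms by linarith
  next
    case False
    then have "A \<inter> B \<subseteq> insert i (A - {j}) \<inter> B" by auto
    then have "card (A \<inter> B) \<le> card (insert i (A - {j}) \<inter> B)"
      using assms by (intro card_mono) auto
    then show ?thesis using assms by linarith
  qed
qed

lemma cross_intersecting_sym: "cross_intersecting t \<A> \<B> \<longleftrightarrow> cross_intersecting t \<B> \<A>"
  unfolding cross_intersecting_def by (metis Int_commute)

lemma cross_intersecting_containing:
  assumes "card T = t" "\<And>A. A \<in> S \<Longrightarrow> finite A"
  shows "cross_intersecting t (containing S T) (containing S' T)"
  unfolding cross_intersecting_def
proof (intro ballI)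
  fix A B assume "A \<in> containing S T" "B \<in> containing S' T"
  then have "T \<subseteq> A \<inter> B" "finite (A \<inter> B)" using assms by (auto simp: containing_def)
  then have "card T \<le> card (A \<inter> B)" by (rule card_mono[rotated])
  then show "t \<le> card (A \<inter> B)" using assms(1) by simp
qed

lemma cross_intersecting_compress:
  assumes cross: "cross_intersecting t \<A> \<B>"
    and fin: "\<And>A. A \<in> \<A> \<Longrightarrow> finite A" "\<And>B. B \<in> \<B> \<Longrightarrow> finite B"
  shows "cross_intersecting t (compress i j \<A>) (compress i j \<B>)"
  unfolding cross_intersecting_def compress_def
proof (intro ballI)
  fix A' B' assume "A' \<in> move i j \<A> ` \<A>" "B' \<in> move i j \<B> ` \<B>"
  then obtain A B where A: "A \<in> \<A>" "A' = move i j \<A> A" and B: "B \<in> \<B>" "B' = move i j \<B> B" by auto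
  have c: "t \<le> card (X \<inter> Y)" if "X \<in> \<A>" "Y \<in> \<B>" for X Y
    using cross that unfolding cross_intersecting_def by blast
  note f = fin(1)[OF A(1)] fin(2)[OF B(1)]
  show "t \<le> card (A' \<inter> B')"
    using A(1)
  proof (cases rule: move_cases[where i = i and j = j])
    case a: fixed
    show ?thesis using B(1)
    proof (cases rule: move_cases[where i = i and j = j])
      case fixed
      then show ?thesis using a A B c by simp
    next
      case moved
      have "t \<le> card (insert i (B - {j}) \<inter> A)"
        by (rule moved_fixed_inter) (use f moved a c[OF A(1) B(1)] c[OF a(2) B(1)] in \<open>auto simp: Int_commute\<close>)
      then show ?thesis using a moved A B by (simp add: Int_commute)
    qed
  next
    case a: moved
    show ?thesis using B(1)
    proof (cases rule: move_cases[where i = i and j = j])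
      case fixed
      have "t \<le> card (insert i (A - {j}) \<inter> B)"
        by (rule moved_fixed_inter) (use f fixed a c[OF A(1) B(1)] c[OF A(1) fixed(2)] in auto)
      then show ?thesis using a fixed A B by simp
    next
      case moved
      then show ?thesis using a A B card_shift_inter[OF f a(2,1)] c[OF A(1) B(1)] by simp
    qed
  qed
qed

text \<open>The potential that makes repeated compression terminate.\<close>

definition total_rank :: "('a \<Rightarrow> nat) \<Rightarrow> 'a set set \<Rightarrow> nat" where
  "total_rank f \<A> = (\<Sum>A\<in>\<A>. sum f A)"

lemma sum_move_le:
  assumes "finite A" "A \<in> \<A>" "f i < (f j :: nat)"
  shows "sum f (move i j \<A> A) \<le> sum f A"
    and "shift i j A \<notin> \<A> \<Longrightarrow> sum f (move i j \<A> A) < sum f A"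
proof -
  have *: "sum f (insert i (A - {j})) < sum f A" if "j \<in> A" "i \<notin> A"
    using assms that by (simp add: sum.remove[of A j])
  show "sum f (move i j \<A> A) \<le> sum f A"
    using assms(2) by (cases rule: move_cases[where i = i and j = j]) (use * in auto)
  show "sum f (move i j \<A> A) < sum f A" if "shift i j A \<notin> \<A>"
    using assms(2) by (cases rule: move_cases[where i = i and j = j]) (use * that in auto)
qed

lemma total_rank_compress:
  assumes "finite \<A>" "\<And>A. A \<in> \<A> \<Longrightarrow> finite A" "f i < f j"
  shows "total_rank f (compress i j \<A>) \<le> total_rank f \<A>"
    and "A \<in> \<A> \<Longrightarrow> shift i j A \<notin> \<A> \<Longrightarrow> total_rank f (compress i j \<A>) < total_rank f \<A>"
proof -
  have eq: "total_rank f (compress i j \<A>) = (\<Sum>A\<in>\<A>. sum f (move i j \<A> A))"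
    unfolding compress_def total_rank_def by (simp add: sum.reindex[OF inj_on_move])
  show "total_rank f (compress i j \<A>) \<le> total_rank f \<A>"
    unfolding eq unfolding total_rank_def by (intro sum_mono sum_move_le assms)
  show "total_rank f (compress i j \<A>) < total_rank f \<A>" if "A \<in> \<A>" "shift i j A \<notin> \<A>"
    unfolding eq unfolding total_rank_def
    by (rule sum_strict_mono_ex1) (use sum_move_le[OF assms(2) _ assms(3)] that assms(1) in blast)+
qed

text \<open>Compression does not change the number of members, so it suffices that all members contain \<open>T\<close>.\<close>

lemma containing_compress_unaffected:
  assumes "compress i j \<A> = containing S T" "\<A> \<subseteq> S" "finite S"
    and nomove: "\<And>A. A \<in> \<A> \<Longrightarrow> j \<in> A \<Longrightarrow> i \<notin> A \<Longrightarrow> T \<subseteq> insert i (A - {j}) \<Longrightarrow> shift i j A \<notin> \<A> \<Longrightarrow> T \<subseteq> A"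
  shows "\<A> = containing S T"
proof (rule card_subset_eq)
  show "finite (containing S T)" using assms by (auto simp: containing_def)
  show "card \<A> = card (containing S T)" using card_compress[of i j \<A>] assms(1) by simp
  show "\<A> \<subseteq> containing S T"
  proof
    fix A assume A: "A \<in> \<A>"
    then have "move i j \<A> A \<in> containing S T" using assms(1) by (auto simp: compress_def)
    then have T: "T \<subseteq> move i j \<A> A" by (simp add: containing_def)
    have "T \<subseteq> A" using A
      by (cases rule: move_cases[where i = i and j = j]) (use T nomove[OF A] in \<open>auto simp: shift_def\<close>)
    then show "A \<in> containing S T" using A assms(2) by (auto simp: containing_def)
  qed
qed

lemma card_containing_shift_le:
  assumes "finite S" "\<And>A. A \<in> S \<Longrightarrow> shift i j A \<in> S" "i \<in> T" "j \<notin> T"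
  shows "card (containing S (insert j (T - {i}))) \<le> card (containing S T)"
proof (rule card_inj_on_le[of "shift i j"])
  show "finite (containing S T)" using assms by (auto simp: containing_def)
  show "shift i j ` containing S (insert j (T - {i})) \<subseteq> containing S T"
    using assms by (auto simp: containing_def) (auto simp: shift_def)
  show "inj_on (shift i j) (containing S (insert j (T - {i})))"
  proof (rule inj_onI)
    fix A B assume "A \<in> containing S (insert j (T - {i}))" "B \<in> containing S (insert j (T - {i}))"
      and eq: "shift i j A = shift i j B"
    then have "j \<in> A" "j \<in> B" by (auto simp: containing_def)
    then show "A = B" using eq unfolding shift_def by (auto split: if_splits)
  qed
qed

lemma containing_compress_all:
  assumes "compress i j \<A> = containing S T" "\<A> \<subseteq> S" "finite S"
    and "\<And>A. A \<in> S \<Longrightarrow> shift i j A \<in> S" "i \<in> T" "j \<notin> T"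
    and all: "\<And>A. A \<in> \<A> \<Longrightarrow> insert j (T - {i}) \<subseteq> A"
  shows "\<A> = containing S (insert j (T - {i}))"
proof (rule card_seteq)
  show "finite (containing S (insert j (T - {i})))" using assms by (auto simp: containing_def)
  show "\<A> \<subseteq> containing S (insert j (T - {i}))" using assms(2) all unfolding containing_def by blast
  show "card (containing S (insert j (T - {i}))) \<le> card \<A>"
    using card_containing_shift_le[OF assms(3-6)] assms(1) card_compress[of i j \<A>] by simp
qed

text \<open>The family \<open>\<A>\<close> has a moved member \<open>A\<close>. A set \<open>F\<close> of the star that
  meets the image of \<open>A\<close> only in \<open>T\<close> cannot come from an unmoved member of
  \<open>\<B>\<close>, which would meet \<open>A\<close> in \<open>T - {i}\<close> only. If there were also a member
  \<open>A'\<close> that does not contain the exchanged kernel \<open>T - {i} \<union> {j}\<close>, then \<open>F\<close>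
  can be chosen to meet \<open>A'\<close> only in \<open>T\<close> as well, and now the moved member of
  \<open>\<B>\<close> that becomes \<open>F\<close> meets \<open>A'\<close> in \<open>T - {i}\<close> only.\<close>

lemma mixed_impossible:
  assumes A: "compress i j \<A> = containing S T" and B: "compress i j \<B> = containing S' T"
    and cross: "cross_intersecting (card T) \<A> \<B>"
    and T: "finite T" "i \<in> T" "j \<notin> T"
    and link: "\<And>E E'. E \<in> containing S T \<Longrightarrow> E' \<in> containing S T \<Longrightarrow>
        \<exists>F\<in>containing S' T. E \<inter> F = T \<and> E' \<inter> F = T \<and> j \<notin> F"
    and mv: "A \<in> \<A>" "shift i j A \<notin> \<A>" and A': "A' \<in> \<A>"
  shows "insert j (T - {i}) \<subseteq> A'"
    and "\<exists>B\<in>\<B>. shift i j B \<notin> \<B>"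
proof -
  have c: "card T \<le> card (X \<inter> Y)" if "X \<in> \<A>" "Y \<in> \<B>" for X Y
    using cross that unfolding cross_intersecting_def by blast
  have small: "\<not> card T \<le> card (T - {i})"
    using T by (metis card_Diff1_less not_le)
  have mA: "j \<in> A" "i \<notin> A" "move i j \<A> A = insert i (A - {j})"
    using mv(1) by (cases rule: move_cases[where i = i and j = j]; use mv in simp)+
  have E: "insert i (A - {j}) \<in> containing S T" using A mA(3) mv(1) by (force simp: compress_def)
  have main: "shift i j B \<notin> \<B> \<and> B = insert j (F - {i})"
    if B1: "B \<in> \<B>" and F: "F = move i j \<B> B" "insert i (A - {j}) \<inter> F = T" "j \<notin> F" for B F
    using B1
  proof (cases rule: move_cases[where i = i and j = j])
    case fixed
    then have "A \<inter> B = T - {i}" using F mA by auto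
    then show ?thesis using c[OF mv(1) B1] small by simp
  next
    case moved
    then show ?thesis using F by (auto simp: shift_def)
  qed
  show "\<exists>B\<in>\<B>. shift i j B \<notin> \<B>"
  proof -
    obtain F where F: "F \<in> containing S' T" "insert i (A - {j}) \<inter> F = T" "j \<notin> F"
      using link[OF E E] by blast
    then obtain B0 where "B0 \<in> \<B>" "F = move i j \<B> B0" using F(1) unfolding B[symmetric] compress_def by blast
    then show ?thesis using main F by blast
  qed
  show "insert j (T - {i}) \<subseteq> A'"
  proof (rule ccontr)
    \<comment> \<open>Such a member did not move, so it contains \<open>T\<close> and therefore lacks \<open>j\<close>.\<close>
    assume n: "\<not> insert j (T - {i}) \<subseteq> A'"
    have m': "move i j \<A> A' \<in> containing S T" using A A' by (auto simp: compress_def)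
    then have T': "T \<subseteq> move i j \<A> A'" by (simp add: containing_def)
    have eq: "move i j \<A> A' = A'" "j \<notin> A'"
      using A' by (cases rule: move_cases[where i = i and j = j]; use T' n T in auto)+
    obtain F where F: "F \<in> containing S' T" "insert i (A - {j}) \<inter> F = T" "A' \<inter> F = T" "j \<notin> F"
      using link[OF E m'] eq by auto
    then obtain B0 where B0: "B0 \<in> \<B>" "F = move i j \<B> B0" using F(1) unfolding B[symmetric] compress_def by blast
    then have "B0 = insert j (F - {i})" using main F by blast
    then have "A' \<inter> B0 = T - {i}" using F(3) eq by auto
    then show False using c[OF A' B0(1)] small by simp
  qed
qed

text \<open>If two families become stars with the same kernel, they were stars with a common kernel before: either no
  member of either family moved, or the kernel was \<open>T - {i} \<union> {j}\<close> for both of them. The two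
  hypotheses on common neighbours exclude a mixture.\<close>

lemma containing_uncompress:
  assumes A: "compress i j \<A> = containing S T" "\<A> \<subseteq> S" "finite S" "\<And>A. A \<in> S \<Longrightarrow> shift i j A \<in> S"
    and B: "compress i j \<B> = containing S' T" "\<B> \<subseteq> S'" "finite S'" "\<And>B. B \<in> S' \<Longrightarrow> shift i j B \<in> S'"
    and cross: "cross_intersecting (card T) \<A> \<B>" and "finite T"
    and link: "\<And>E E'. j \<notin> T \<Longrightarrow> E \<in> containing S T \<Longrightarrow> E' \<in> containing S T \<Longrightarrow>
        \<exists>F\<in>containing S' T. E \<inter> F = T \<and> E' \<inter> F = T \<and> (i \<in> T \<longrightarrow> j \<notin> F)"
    and link': "\<And>F F'. j \<notin> T \<Longrightarrow> F \<in> containing S' T \<Longrightarrow> F' \<in> containing S' T \<Longrightarrow>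
        \<exists>E\<in>containing S T. F \<inter> E = T \<and> F' \<inter> E = T \<and> (i \<in> T \<longrightarrow> j \<notin> E)"
  shows "\<exists>T'. finite T' \<and> card T' = card T \<and> \<A> = containing S T' \<and> \<B> = containing S' T'"
proof (cases "i \<in> T \<and> j \<notin> T")
  case False
  have "\<A> = containing S T"
    by (rule containing_compress_unaffected[OF A(1-3)]) (use False in auto)
  moreover have "\<B> = containing S' T"
    by (rule containing_compress_unaffected[OF B(1-3)]) (use False in auto)
  ultimately show ?thesis using \<open>finite T\<close> by blast
next
  case True
  then have T: "finite T" "i \<in> T" "j \<notin> T" using \<open>finite T\<close> by auto
  have lA: "\<exists>F\<in>containing S' T. E \<inter> F = T \<and> E' \<inter> F = T \<and> j \<notin> F"
    if "E \<in> containing S T" "E' \<in> containing S T" for E E' using link[OF T(3) that] T(2) by simp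
  have lB: "\<exists>E\<in>containing S T. F \<inter> E = T \<and> F' \<inter> E = T \<and> j \<notin> E"
    if "F \<in> containing S' T" "F' \<in> containing S' T" for F F' using link'[OF T(3) that] T(2) by simp
  have cross': "cross_intersecting (card T) \<B> \<A>" using cross cross_intersecting_sym by blast
  have mA: "(\<forall>A'\<in>\<A>. insert j (T - {i}) \<subseteq> A') \<and> (\<exists>B\<in>\<B>. shift i j B \<notin> \<B>)"
    if "A \<in> \<A>" "shift i j A \<notin> \<A>" for A
    using mixed_impossible[OF A(1) B(1) cross T lA that] that(1) by (intro conjI ballI)
  have mB: "(\<forall>B'\<in>\<B>. insert j (T - {i}) \<subseteq> B') \<and> (\<exists>A\<in>\<A>. shift i j A \<notin> \<A>)"
    if "B \<in> \<B>" "shift i j B \<notin> \<B>" for B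
    using mixed_impossible[OF B(1) A(1) cross' T lB that] that(1) by (intro conjI ballI)
  show ?thesis
  proof (cases "\<exists>A\<in>\<A>. shift i j A \<notin> \<A>")
    case True
    then obtain A0 where A0: "A0 \<in> \<A>" "shift i j A0 \<notin> \<A>" by blast
    obtain B0 where B0: "B0 \<in> \<B>" "shift i j B0 \<notin> \<B>" using conjunct2[OF mA[OF A0]] by blast
    have allA: "insert j (T - {i}) \<subseteq> A'" if "A' \<in> \<A>" for A'
      by (rule bspec[OF conjunct1[OF mA[OF A0]] that])
    have allB: "insert j (T - {i}) \<subseteq> B'" if "B' \<in> \<B>" for B'
      by (rule bspec[OF conjunct1[OF mB[OF B0]] that])
    have "\<A> = containing S (insert j (T - {i}))"
      by (rule containing_compress_all[OF A T(2,3) allA])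
    moreover have "\<B> = containing S' (insert j (T - {i}))"
      by (rule containing_compress_all[OF B T(2,3) allB])
    moreover have "card (insert j (T - {i})) = card T"
      using T by (metis card_Suc_Diff1 card_insert_disjoint finite_Diff Diff_iff)
    ultimately show ?thesis using T(1) by (intro exI[of _ "insert j (T - {i})"] conjI) simp_all
  next
    case False
    then have nB: "\<not> (\<exists>B\<in>\<B>. shift i j B \<notin> \<B>)" using mB by blast
    have "\<A> = containing S T"
      by (rule containing_compress_unaffected[OF A(1-3)]) (use False in auto)
    moreover have "\<B> = containing S' T"
      by (rule containing_compress_unaffected[OF B(1-3)]) (use nB in auto)
    ultimately show ?thesis using T by blast
  qed
qed

section \<open>Weights on sets of naturals and their traces\<close>

text \<open>Compression at every \<open>i < j\<close> leaves such a family unchanged.\<close>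

definition stable :: "nat set set \<Rightarrow> bool" where
  "stable \<A> \<longleftrightarrow> (\<forall>A\<in>\<A>. \<forall>i j. 1 \<le> i \<longrightarrow> i < j \<longrightarrow> shift i j A \<in> \<A>)"

lemma stableD:
  assumes "stable \<A>" "A \<in> \<A>" "1 \<le> i" "i < j" "j \<in> A" "i \<notin> A"
  shows "insert i (A - {j}) \<in> \<A>"
  using assms unfolding stable_def shift_def by metis

lemma sum_le_sum_inj:
  fixes f :: "'a \<Rightarrow> real" and g :: "'b \<Rightarrow> real"
  assumes "inj_on \<phi> S" "\<phi> ` S \<subseteq> T" "finite T" "\<And>y. y \<in> T \<Longrightarrow> 0 \<le> g y"
    and "\<And>x. x \<in> S \<Longrightarrow> f x \<le> g (\<phi> x)"
  shows "sum f S \<le> sum g T"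
proof -
  have "sum f S \<le> (\<Sum>x\<in>S. g (\<phi> x))" by (intro sum_mono assms)
  also have "\<dots> = sum g (\<phi> ` S)" using assms(1) by (simp add: sum.reindex)
  also have "\<dots> \<le> sum g T" by (intro sum_mono2) (use assms in auto)
  finally show ?thesis .
qed

lemma near_full_cases:
  assumes "Q \<subseteq> {1..p}" "p \<le> card Q + 1"
  shows "Q = {1..p} \<or> (\<exists>x\<in>{1..p}. Q = {1..p} - {x})"
proof -
  have "card ({1..p} - Q) = p - card Q" using assms by (simp add: card_Diff_subset finite_subset)
  then have "card ({1..p} - Q) \<le> 1" using assms by simp
  then consider "{1..p} - Q = {}" | x where "{1..p} - Q = {x}"
    by (metis card_1_singletonE card_eq_0_iff finite_Diff finite_atLeastAtMost le_0_eq le_Suc_eq One_nat_def)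
  then show ?thesis
  proof cases
    case 1
    then show ?thesis using assms by auto
  next
    case 2
    then have "x \<in> {1..p}" "Q = {1..p} - {x}" using assms by auto
    then show ?thesis by blast
  qed
qed

lemma missing_one:
  assumes "Q \<subseteq> {1..p}" "p = card Q + 1"
  obtains x where "x \<in> {1..p}" "Q = {1..p} - {x}"
proof -
  have "Q \<noteq> {1..p}" using assms(2) by (metis card_atLeastAtMost diff_add_inverse2 n_not_Suc_n Suc_eq_plus1)
  then have "\<exists>x\<in>{1..p}. Q = {1..p} - {x}" using near_full_cases[OF assms(1)] assms(2) by simp
  then show ?thesis using that by blast
qed

lemma sandwiched_sets:
  "{Q. T \<subseteq> Q \<and> Q \<subseteq> insert b (insert a T)} = {T, insert a T, insert b T, insert b (insert a T)}"
proof -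
  have "Q = T \<or> Q = insert a T \<or> Q = insert b T \<or> Q = insert b (insert a T)"
    if "T \<subseteq> Q" "Q \<subseteq> insert b (insert a T)" for Q
    using that by (cases "a \<in> Q"; cases "b \<in> Q") blast+
  then show ?thesis by blast
qed

lemma sum_four:
  fixes f :: "'a \<Rightarrow> real"
  assumes "a \<noteq> b" "a \<noteq> c" "a \<noteq> d" "b \<noteq> c" "b \<noteq> d" "c \<noteq> d"
  shows "sum f {a, b, c, d} = f a + f b + f c + f d"
  using assms by simp

text \<open>The weight of a set vanishes outside \<open>{1..m}\<close>; hence both inequalities can be required for
  arbitrary sets, and the sets of positive weight form a finite down-closed family.\<close>

locale shift_weight =
  fixes m :: nat and lam :: real and g :: "nat set \<Rightarrow> real"
  assumes nonneg: "0 \<le> g A"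
    and support: "0 < g A \<Longrightarrow> A \<subseteq> {1..m}"
    and shift_le: "1 \<le> i \<Longrightarrow> i < j \<Longrightarrow> g A \<le> g (shift i j A)"
    and drop_le: "x \<in> A \<Longrightarrow> lam * g A \<le> g (A - {x})"
    and lam_gt: "2 < lam"
begin

lemma finite_support: "finite {A. 0 < g A}"
  by (rule finite_subset[of _ "Pow {1..m}"]) (use support in auto)

lemma finite_in_support: "0 < g A \<Longrightarrow> finite A"
  using support finite_subset by (metis finite_atLeastAtMost)

text \<open>Traces inherit both inequalities of the weight, so that the final comparisons with a star involve only a
  handful of numbers.\<close>

definition trace_weight :: "nat \<Rightarrow> nat set \<Rightarrow> real" where
  "trace_weight p Q = sum g {A \<in> Pow {1..m}. A \<inter> {1..p} = Q}"

lemma trace_weight_nonneg: "0 \<le> trace_weight p Q"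
  unfolding trace_weight_def by (simp add: sum_nonneg nonneg)

lemma trace_weight_drop:
  assumes "x \<in> Q" shows "lam * trace_weight p Q \<le> trace_weight p (Q - {x})"
  unfolding trace_weight_def sum_distrib_left
proof (rule sum_le_sum_inj[where \<phi> = "\<lambda>A. A - {x}"])
  show "inj_on (\<lambda>A. A - {x}) {A \<in> Pow {1..m}. A \<inter> {1..p} = Q}"
  proof (rule inj_onI)
    fix A B assume "A \<in> {A \<in> Pow {1..m}. A \<inter> {1..p} = Q}" "B \<in> {A \<in> Pow {1..m}. A \<inter> {1..p} = Q}"
      and eq: "A - {x} = B - {x}"
    then have "x \<in> A" "x \<in> B" using assms by auto
    then show "A = B" using eq by (metis insert_Diff)
  qed
qed (use assms nonneg drop_le in auto)

lemma trace_weight_shift: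
  assumes "1 \<le> i" "i < j" "j \<le> p" "j \<in> Q" "i \<notin> Q"
  shows "trace_weight p Q \<le> trace_weight p (insert i (Q - {j}))"
  unfolding trace_weight_def
proof (rule sum_le_sum_inj[where \<phi> = "\<lambda>A. insert i (A - {j})"])
  have *: "j \<in> A \<and> i \<notin> A" if "A \<in> {A \<in> Pow {1..m}. A \<inter> {1..p} = Q}" for A
    using that assms by auto
  show "inj_on (\<lambda>A. insert i (A - {j})) {A \<in> Pow {1..m}. A \<inter> {1..p} = Q}"
  proof (rule inj_onI)
    fix A B assume AB: "A \<in> {A \<in> Pow {1..m}. A \<inter> {1..p} = Q}" "B \<in> {A \<in> Pow {1..m}. A \<inter> {1..p} = Q}"
      and eq: "insert i (A - {j}) = insert i (B - {j})"
    have "A - {j} = B - {j}" using *[OF AB(1)] *[OF AB(2)] eq by (metis Diff_iff insert_ident)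
    then show "A = B" using *[OF AB(1)] *[OF AB(2)] by (metis insert_Diff)
  qed
  show "(\<lambda>A. insert i (A - {j})) ` {A \<in> Pow {1..m}. A \<inter> {1..p} = Q}
      \<subseteq> {A \<in> Pow {1..m}. A \<inter> {1..p} = insert i (Q - {j})}"
  proof (rule image_subsetI)
    fix A assume A: "A \<in> {A \<in> Pow {1..m}. A \<inter> {1..p} = Q}"
    then have "j \<in> A" "A \<subseteq> {1..m}" "A \<inter> {1..p} = Q" using *[OF A] by simp_all
    then have "i \<in> {1..m}" "i \<in> {1..p}" using assms(1-3) by auto
    then have "insert i (A - {j}) \<in> Pow {1..m}" using \<open>A \<subseteq> {1..m}\<close> by blast
    moreover have "insert i (A - {j}) \<inter> {1..p} = insert i (Q - {j})"
      using \<open>i \<in> {1..p}\<close> \<open>A \<inter> {1..p} = Q\<close> by blast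
    ultimately show "insert i (A - {j}) \<in> {A \<in> Pow {1..m}. A \<inter> {1..p} = insert i (Q - {j})}" by simp
  qed
  show "g A \<le> g (insert i (A - {j}))" if "A \<in> {A \<in> Pow {1..m}. A \<inter> {1..p} = Q}" for A
    using shift_le[OF assms(1,2), of A] *[OF that] by (simp add: shift_def)
qed (use nonneg in auto)

lemma sum_trace_weight:
  assumes "finite \<Q>"
  shows "sum (trace_weight p) \<Q> = sum g {A \<in> Pow {1..m}. A \<inter> {1..p} \<in> \<Q>}"
proof -
  have "sum g (\<Union>Q\<in>\<Q>. {A \<in> Pow {1..m}. A \<inter> {1..p} = Q}) = sum (trace_weight p) \<Q>"
    unfolding trace_weight_def by (rule sum.UNION_disjoint) (use assms in auto)
  moreover have "(\<Union>Q\<in>\<Q>. {A \<in> Pow {1..m}. A \<inter> {1..p} = Q}) = {A \<in> Pow {1..m}. A \<inter> {1..p} \<in> \<Q>}" by auto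
  ultimately show ?thesis by simp
qed

lemma sum_le_traces:
  assumes "\<A> \<subseteq> {A. 0 < g A}" "\<And>A. A \<in> \<A> \<Longrightarrow> A \<inter> {1..p} \<in> \<Q>" "finite \<Q>"
  shows "sum g \<A> \<le> sum (trace_weight p) \<Q>"
  unfolding sum_trace_weight[OF assms(3)]
  by (rule sum_mono2) (use assms support nonneg in auto)

definition star_weight :: "nat \<Rightarrow> real" where
  "star_weight t = sum g (containing {A. 0 < g A} {1..t})"

lemma star_weight_traces:
  assumes "t \<le> p"
  shows "star_weight t = sum (trace_weight p) {Q. {1..t} \<subseteq> Q \<and> Q \<subseteq> {1..p}}"
proof -
  have fin: "finite {Q. {1..t} \<subseteq> Q \<and> Q \<subseteq> {1..p}}"
    by (rule finite_subset[of _ "Pow {1..p}"]) auto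
  have sub: "{1..t} \<subseteq> {1..p}" using assms by auto
  show ?thesis unfolding sum_trace_weight[OF fin] star_weight_def containing_def
  proof (rule sum.mono_neutral_left)
    show "{A \<in> {A. 0 < g A}. {1..t} \<subseteq> A} \<subseteq> {A \<in> Pow {1..m}. A \<inter> {1..p} \<in> {Q. {1..t} \<subseteq> Q \<and> Q \<subseteq> {1..p}}}"
      using support sub by auto
    show "\<forall>A\<in>{A \<in> Pow {1..m}. A \<inter> {1..p} \<in> {Q. {1..t} \<subseteq> Q \<and> Q \<subseteq> {1..p}}} - {A \<in> {A. 0 < g A}. {1..t} \<subseteq> A}. g A = 0"
      using nonneg by (auto simp: order.order_iff_strict)
  qed auto
qed

lemma star_weight_Suc:
  "star_weight t = trace_weight (t+1) {1..t} + trace_weight (t+1) {1..t+1}"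
proof -
  have "{Q. {1..t} \<subseteq> Q \<and> Q \<subseteq> {1..t+1}} = {{1..t}, {1..t+1}}" (is "?L = ?R")
  proof -
    have "{1..t+1} = insert (t+1) {1..t}" by auto
    moreover have "{Q. {1..t} \<subseteq> Q \<and> Q \<subseteq> insert (t+1) {1..t}} = {{1..t}, insert (t+1) {1..t}}"
      by (auto simp: subset_insert_iff)
    ultimately show ?thesis by simp
  qed
  moreover have "{1..t} \<noteq> {1..t+1}" by auto
  ultimately show ?thesis using star_weight_traces[of t "t+1"] by simp
qed

lemma star_weight_Suc_Suc:
  "star_weight t = trace_weight (t+2) {1..t} + trace_weight (t+2) {1..t+1}
    + trace_weight (t+2) ({1..t+2} - {t+1}) + trace_weight (t+2) {1..t+2}"
proof -
  let ?b = "{1..t+2} - {t+1}"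
  have e: "{1..t+1} = insert (t+1) {1..t}" "?b = insert (t+2) {1..t}"
    "{1..t+2} = insert (t+2) (insert (t+1) {1..t})" by auto
  have "{Q. {1..t} \<subseteq> Q \<and> Q \<subseteq> {1..t+2}} = {{1..t}, {1..t+1}, ?b, {1..t+2}}"
    unfolding e(2) unfolding e(1,3) by (rule sandwiched_sets)
  then have "star_weight t = sum (trace_weight (t+2)) {{1..t}, {1..t+1}, ?b, {1..t+2}}"
    using star_weight_traces[of t "t+2"] by simp
  also have "\<dots> = trace_weight (t+2) {1..t} + trace_weight (t+2) {1..t+1}
    + trace_weight (t+2) ?b + trace_weight (t+2) {1..t+2}"
  proof (rule sum_four)
    have n: "t+1 \<notin> {1..t}" "t+2 \<notin> {1..t}" "t+1 \<notin> ?b" "t+2 \<notin> {1..t+1}" by simp_all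
    have i: "t+1 \<in> {1..t+1}" "t+1 \<in> {1..t+2}" "t+2 \<in> ?b" "t+2 \<in> {1..t+2}" by simp_all
    show "{1..t} \<noteq> {1..t+1}" by (rule notI) (use n(1) i(1) in metis)
    show "{1..t} \<noteq> ?b" by (rule notI) (use n(2) i(3) in metis)
    show "{1..t} \<noteq> {1..t+2}" by (rule notI) (use n(2) i(4) in metis)
    show "{1..t+1} \<noteq> ?b" by (rule notI) (use n(3) i(1) in metis)
    show "{1..t+1} \<noteq> {1..t+2}" by (rule notI) (use n(4) i(4) in metis)
    show "?b \<noteq> {1..t+2}" by (rule notI) (use n(3) i(2) in metis)
  qed
  finally show ?thesis .
qed

lemma near_full_weight:
  assumes "\<A> \<subseteq> {A. 0 < g A}" "\<And>A. A \<in> \<A> \<Longrightarrow> p \<le> card (A \<inter> {1..p}) + 1"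
  shows "sum g \<A> \<le> trace_weight p {1..p} + (\<Sum>x\<in>{1..p}. trace_weight p ({1..p} - {x}))"
proof -
  let ?\<Q> = "insert {1..p} ((\<lambda>x. {1..p} - {x}) ` {1..p})"
  have "sum g \<A> \<le> sum (trace_weight p) ?\<Q>"
  proof (rule sum_le_traces[OF assms(1)])
    show "A \<inter> {1..p} \<in> ?\<Q>" if "A \<in> \<A>" for A
      using near_full_cases[of "A \<inter> {1..p}" p] assms(2)[OF that] by auto
  qed auto
  also have "\<dots> = trace_weight p {1..p} + sum (trace_weight p) ((\<lambda>x. {1..p} - {x}) ` {1..p})"
    by (rule sum.insert) auto
  also have "sum (trace_weight p) ((\<lambda>x. {1..p} - {x}) ` {1..p}) = (\<Sum>x\<in>{1..p}. trace_weight p ({1..p} - {x}))"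
    by (subst sum.reindex) (auto simp: inj_on_def)
  finally show ?thesis by simp
qed

text \<open>Among the traces that miss one point of \<open>{1..p}\<close>, the later the gap the larger the weight, since
  the gap can be shifted to the right by moving an element to the left.\<close>

lemma trace_weight_missing_mono:
  assumes "1 \<le> x" "x \<le> y" "y \<le> p"
  shows "trace_weight p ({1..p} - {x}) \<le> trace_weight p ({1..p} - {y})"
proof (cases "x = y")
  case False
  then have "insert x (({1..p} - {x}) - {y}) = {1..p} - {y}" using assms by auto
  moreover have "trace_weight p ({1..p} - {x}) \<le> trace_weight p (insert x (({1..p} - {x}) - {y}))"
    by (rule trace_weight_shift) (use assms False in auto)
  ultimately show ?thesis by simp
qed simp

text \<open>In a shifted family the sets that contain \<open>p\<close> and have \<open>i\<close> elements in
  \<open>{1..p}\<close> carry at most the share \<open>i/p\<close>. Each of them yields \<open>p - i\<close> members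
  of at least the same weight, by moving \<open>p\<close> to a gap. These do not contain \<open>p\<close>, and each
  arises at most \<open>i\<close> times, since it is determined by which of its \<open>i\<close> elements in
  \<open>{1..p}\<close> was inserted.\<close>

lemma critical_share:
  assumes pos: "\<A> \<subseteq> {A. 0 < g A}" and st: "stable \<A>" and R: "R \<subseteq> \<A>" "\<And>A. A \<in> R \<Longrightarrow> p \<in> A \<and> card (A \<inter> {1..p}) = i"
  shows "real p * sum g R \<le> real i * sum g \<A>"
proof -
  have fin: "finite \<A>" using pos finite_support finite_subset by blast
  then have finR: "finite R" using R finite_subset by blast
  define C where "C = \<A> - R"
  let ?C = "{A \<in> C. card (A \<inter> {1..p}) = i}"
  \<comment> \<open>Recording the gap makes the map injective; a set \<open>C\<close> then occurs at most once for each of its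
    elements in \<open>{1..p}\<close>.\<close>
  let ?f = "\<lambda>(A, x). (insert x (A - {p}), x)"
  have "(real p - real i) * sum g R \<le> (\<Sum>A\<in>R. (real p - real i) * g A)"
    by (simp add: sum_distrib_left)
  also have "\<dots> = (\<Sum>A\<in>R. \<Sum>x\<in>{1..p} - A. g A)"
  proof (rule sum.cong)
    fix A assume A: "A \<in> R"
    have "card ({1..p} - A) = card ({1..p} - (A \<inter> {1..p}))" by (rule arg_cong[of _ _ card]) auto
    also have "\<dots> = p - i" using R(2)[OF A] by (subst card_Diff_subset) auto
    finally have "card ({1..p} - A) = p - i" .
    moreover have "i \<le> p" using R(2)[OF A] card_mono[of "{1..p}" "A \<inter> {1..p}"] by auto
    ultimately show "(real p - real i) * g A = (\<Sum>x\<in>{1..p} - A. g A)" by (simp add: of_nat_diff)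
  qed simp
  also have "\<dots> = (\<Sum>(A, x)\<in>(SIGMA A:R. {1..p} - A). g A)"
    by (rule sum.Sigma) (use finR in auto)
  also have "\<dots> \<le> (\<Sum>(A, x)\<in>(SIGMA A:?C. A \<inter> {1..p}). g A)"
  proof (rule sum_le_sum_inj[where \<phi> = ?f])
    show "inj_on ?f (SIGMA A:R. {1..p} - A)"
    proof (rule inj_onI)
      fix u v assume u: "u \<in> (SIGMA A:R. {1..p} - A)" and v: "v \<in> (SIGMA A:R. {1..p} - A)" and eq: "?f u = ?f v"
      obtain A x B y where uv: "u = (A, x)" "v = (B, y)" by fastforce
      have "x = y" "x \<notin> A" "x \<notin> B" "p \<in> A" "p \<in> B" using u v eq R(2) uv by auto
      moreover have "insert x (A - {p}) = insert x (B - {p})" using eq uv by auto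
      ultimately have "A - {p} = B - {p}" by (metis Diff_iff insert_ident)
      then have "A = B" using \<open>p \<in> A\<close> \<open>p \<in> B\<close> by (metis insert_Diff)
      then show "u = v" using uv \<open>x = y\<close> by simp
    qed
    show "?f ` (SIGMA A:R. {1..p} - A) \<subseteq> (SIGMA A:?C. A \<inter> {1..p})"
    proof (rule image_subsetI)
      fix u assume u: "u \<in> (SIGMA A:R. {1..p} - A)"
      obtain A x where ux: "u = (A, x)" by fastforce
      have A: "A \<in> R" "x \<in> {1..p}" "x \<notin> A" using u ux by auto
      have p: "p \<in> A" "card (A \<inter> {1..p}) = i" using R(2)[OF A(1)] by auto
      have xp: "x < p" using A p by (metis atLeastAtMost_iff order_le_less)
      have "insert x (A - {p}) \<in> \<A>" by (rule stableD[OF st]) (use A R(1) xp p in auto)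
      moreover have "insert x (A - {p}) \<notin> R" using R(2)[of "insert x (A - {p})"] xp by auto
      moreover have "card (insert x (A - {p}) \<inter> {1..p}) = i"
      proof -
        have "insert x (A - {p}) \<inter> {1..p} = insert x ((A \<inter> {1..p}) - {p})" using A by auto
        then have "card (insert x (A - {p}) \<inter> {1..p}) = Suc (card ((A \<inter> {1..p}) - {p}))"
          using A by simp
        also have "\<dots> = card (A \<inter> {1..p})" using p xp by (intro card_Suc_Diff1) auto
        finally show ?thesis using p by simp
      qed
      ultimately show "?f u \<in> (SIGMA A:?C. A \<inter> {1..p})" using ux A by (simp add: C_def)
    qed
    show "finite (SIGMA A:?C. A \<inter> {1..p})" using fin C_def by auto
    show "(case x of (A, x) \<Rightarrow> g A) \<le> (case ?f x of (A, x) \<Rightarrow> g A)"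
      if u: "x \<in> (SIGMA A:R. {1..p} - A)" for x
    proof -
      obtain A y where ux: "x = (A, y)" by fastforce
      have A: "A \<in> R" "y \<in> {1..p}" "y \<notin> A" using u ux by auto
      have p: "p \<in> A" using R(2)[OF A(1)] by auto
      have "y < p" using A p by (metis atLeastAtMost_iff order_le_less)
      then have "g A \<le> g (shift y p A)" using shift_le A by auto
      then show ?thesis using ux p A by (simp add: shift_def)
    qed
  qed (use nonneg in auto)
  also have "\<dots> = (\<Sum>A\<in>?C. \<Sum>x\<in>A \<inter> {1..p}. g A)"
    by (rule sum.Sigma[symmetric]) (use fin C_def in auto)
  also have "\<dots> = (\<Sum>A\<in>?C. real i * g A)" by (rule sum.cong) auto
  also have "\<dots> \<le> (\<Sum>A\<in>C. real i * g A)"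
    by (rule sum_mono2) (use fin C_def nonneg in auto)
  also have "\<dots> = real i * (sum g \<A> - sum g R)"
    unfolding C_def using fin R(1) by (simp add: sum_distrib_left[symmetric] sum_diff)
  finally show ?thesis by (simp add: algebra_simps)
qed

end

section \<open>Altering an optimal pair\<close>

definition optimal_pair :: "nat \<Rightarrow> (nat set \<Rightarrow> real) \<Rightarrow> (nat set \<Rightarrow> real) \<Rightarrow> nat set set \<Rightarrow> nat set set \<Rightarrow> bool" where
  "optimal_pair t g h \<A> \<B> \<longleftrightarrow>
     \<A> \<subseteq> {A. 0 < g A} \<and> \<B> \<subseteq> {B. 0 < h B} \<and> cross_intersecting t \<A> \<B> \<and>
     (\<forall>\<A>' \<B>'. \<A>' \<subseteq> {A. 0 < g A} \<and> \<B>' \<subseteq> {B. 0 < h B} \<and> cross_intersecting t \<A>' \<B>' \<longrightarrow>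
        sum g \<A>' * sum h \<B>' \<le> sum g \<A> * sum h \<B>)"

lemma optimal_pair_sym:
  assumes "optimal_pair t g h \<A> \<B>" shows "optimal_pair t h g \<B> \<A>"
proof -
  have *: "sum h \<B>' * sum g \<A>' \<le> sum h \<B> * sum g \<A>"
    if "\<A>' \<subseteq> {A. 0 < g A}" "\<B>' \<subseteq> {B. 0 < h B}" "cross_intersecting t \<B>' \<A>'" for \<A>' \<B>'
  proof -
    have "sum g \<A>' * sum h \<B>' \<le> sum g \<A> * sum h \<B>"
      using assms that cross_intersecting_sym[of t \<B>' \<A>'] unfolding optimal_pair_def by blast
    then show ?thesis by (simp add: mult.commute)
  qed
  have "cross_intersecting t \<B> \<A>"
    using assms cross_intersecting_sym[of t \<B> \<A>] unfolding optimal_pair_def by blast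
  moreover have "\<B> \<subseteq> {B. 0 < h B}" "\<A> \<subseteq> {A. 0 < g A}" using assms unfolding optimal_pair_def by blast+
  ultimately show ?thesis using * unfolding optimal_pair_def by (intro conjI allI impI) simp_all
qed

text \<open>The members of size \<open>i\<close> inside \<open>{1..p}\<close> for which the loss of \<open>p\<close> would be fatal:
  some member of the other family meets them in only \<open>t\<close> elements of \<open>{1..p}\<close>, one of which
  is \<open>p\<close>.\<close>

definition critical :: "nat \<Rightarrow> nat \<Rightarrow> nat \<Rightarrow> nat set set \<Rightarrow> nat set set \<Rightarrow> nat set set" where
  "critical t p i \<A> \<B> =
     {A \<in> \<A>. p \<in> A \<and> card (A \<inter> {1..p}) = i \<and> (\<exists>B\<in>\<B>. p \<in> B \<and> card (A \<inter> B \<inter> {1..p}) = t)}"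

text \<open>A common gap \<open>x < p\<close> of the two sets could be filled in \<open>A\<close> by moving \<open>p\<close> to
  \<open>x\<close>, which would leave only \<open>t - 1\<close> common elements inside \<open>{1..p}\<close>.\<close>

lemma critical_union:
  assumes st: "stable \<A>"
    and common: "\<And>A B. A \<in> \<A> \<Longrightarrow> B \<in> \<B> \<Longrightarrow> t \<le> card (A \<inter> B \<inter> {1..p})"
    and AB: "A \<in> \<A>" "B \<in> \<B>" "p \<in> A" "p \<in> B" "card (A \<inter> B \<inter> {1..p}) = t" "1 \<le> p"
  shows "{1..p} \<subseteq> A \<union> B" and "card (A \<inter> {1..p}) + card (B \<inter> {1..p}) = p + t"
proof -
  show *: "{1..p} \<subseteq> A \<union> B"
  proof (rule ccontr)
    assume "\<not> {1..p} \<subseteq> A \<union> B"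
    then obtain x where x: "x \<in> {1..p}" "x \<notin> A" "x \<notin> B" by blast
    then have xp: "x < p" using AB by (metis atLeastAtMost_iff order_le_less)
    have "insert x (A - {p}) \<in> \<A>" by (rule stableD[OF st]) (use AB x xp in auto)
    then have "t \<le> card (insert x (A - {p}) \<inter> B \<inter> {1..p})" using common AB by blast
    also have "insert x (A - {p}) \<inter> B \<inter> {1..p} = (A \<inter> B \<inter> {1..p}) - {p}" using x by auto
    also have "card \<dots> < card (A \<inter> B \<inter> {1..p})" using AB by (intro card_Diff1_less) auto
    finally show False using AB by simp
  qed
  have "card (A \<inter> {1..p}) + card (B \<inter> {1..p}) =
      card ((A \<inter> {1..p}) \<union> (B \<inter> {1..p})) + card ((A \<inter> {1..p}) \<inter> (B \<inter> {1..p}))"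
    by (rule card_Un_Int) auto
  moreover have "(A \<inter> {1..p}) \<union> (B \<inter> {1..p}) = {1..p}" using * by auto
  moreover have "(A \<inter> {1..p}) \<inter> (B \<inter> {1..p}) = A \<inter> B \<inter> {1..p}" by auto
  ultimately show "card (A \<inter> {1..p}) + card (B \<inter> {1..p}) = p + t" using AB by simp
qed

text \<open>A set \<open>A - {p}\<close>, with \<open>A\<close> critical of size \<open>i\<close>, conflicts only with those
  \<open>B\<close> for which \<open>(A, B)\<close> is a critical pair, and these have size \<open>p + t - i\<close>. So
  adjoining the former and deleting the latter gives a cross-\<open>t\<close>-intersecting pair again. The adjoined
  sets are new, and their weight is at least \<open>lam\<close> times that of the critical sets.\<close>

lemma alteration:
  assumes W: "shift_weight m lam g" and W': "shift_weight n lam h" and opt: "optimal_pair t g h \<A> \<B>"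
    and st: "stable \<A>" and p: "1 \<le> p" "1 \<le> t" and ij: "i + j = p + t"
    and common: "\<And>A B. A \<in> \<A> \<Longrightarrow> B \<in> \<B> \<Longrightarrow> t \<le> card (A \<inter> B \<inter> {1..p})"
  shows "(sum g \<A> + lam * sum g (critical t p i \<A> \<B>)) * (sum h \<B> - sum h (critical t p j \<B> \<A>))
      \<le> sum g \<A> * sum h \<B>"
proof -
  interpret W: shift_weight m lam g by fact
  interpret W': shift_weight n lam h by fact
  let ?R = "critical t p i \<A> \<B>" and ?S = "critical t p j \<B> \<A>"
  let ?R' = "(\<lambda>A. A - {p}) ` ?R"
  have posA: "\<A> \<subseteq> {A. 0 < g A}" and posB: "\<B> \<subseteq> {B. 0 < h B}" and cross: "cross_intersecting t \<A> \<B>"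
    using opt by (auto simp: optimal_pair_def)
  have finA: "finite \<A>" using posA W.finite_support finite_subset by blast
  have finB: "finite \<B>" using posB W'.finite_support finite_subset by blast
  have finset: "finite A" if "A \<in> \<A>" for A
    using that posA W.support[of A] finite_subset[of A "{1..m}"] by auto
  have RA: "?R \<subseteq> \<A>" and SB: "?S \<subseteq> \<B>" by (auto simp: critical_def)
  have disj: "\<A> \<inter> ?R' = {}"
  proof (rule ccontr)
    assume "\<A> \<inter> ?R' \<noteq> {}"
    then obtain A where A: "A \<in> ?R" "A - {p} \<in> \<A>" by auto
    then obtain B where B: "B \<in> \<B>" "p \<in> B" "card (A \<inter> B \<inter> {1..p}) = t" "p \<in> A" by (auto simp: critical_def)
    have "(A - {p}) \<inter> B \<inter> {1..p} = (A \<inter> B \<inter> {1..p}) - {p}" by auto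
    moreover have "card ((A \<inter> B \<inter> {1..p}) - {p}) < card (A \<inter> B \<inter> {1..p})"
      using B p by (intro card_Diff1_less) auto
    ultimately show False using common[OF A(2) B(1)] B by simp
  qed
  have "\<A> \<union> ?R' \<subseteq> {A. 0 < g A}"
  proof -
    have "0 < g (A - {p})" if "A \<in> ?R" for A
    proof -
      have "0 < lam * g A" "p \<in> A" using that posA W.lam_gt by (auto simp: critical_def)
      then show ?thesis using W.drop_le[of p A] by linarith
    qed
    then show ?thesis using posA by auto
  qed
  moreover have "\<B> - ?S \<subseteq> {B. 0 < h B}" using posB by auto
  moreover have "cross_intersecting t (\<A> \<union> ?R') (\<B> - ?S)"
    unfolding cross_intersecting_def
  proof (intro ballI)
    fix A' B assume A': "A' \<in> \<A> \<union> ?R'" and B: "B \<in> \<B> - ?S"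
    show "t \<le> card (A' \<inter> B)"
    proof (cases "A' \<in> \<A>")
      case True
      then show ?thesis using cross B unfolding cross_intersecting_def by blast
    next
      case False
      then obtain A where A: "A \<in> ?R" "A' = A - {p}" using A' by auto
      then have AA: "A \<in> \<A>" "p \<in> A" "card (A \<inter> {1..p}) = i" by (auto simp: critical_def)
      show ?thesis
      proof (cases "p \<in> B")
        case False
        then have "A' \<inter> B = A \<inter> B" using A by auto
        then show ?thesis using cross B AA unfolding cross_intersecting_def by auto
      next
        case True
        have "card (A \<inter> B \<inter> {1..p}) \<noteq> t"
        proof
          assume c: "card (A \<inter> B \<inter> {1..p}) = t"
          have "card (A \<inter> {1..p}) + card (B \<inter> {1..p}) = p + t"
            by (rule critical_union(2)[OF st common]) (use AA B True c p in auto)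
          then have "card (B \<inter> {1..p}) = j" using ij AA by simp
          then have "B \<in> ?S" using B True c AA by (auto simp: critical_def Int_commute)
          then show False using B by simp
        qed
        then have "Suc t \<le> card (A \<inter> B \<inter> {1..p})" using common[of A B] AA B by auto
        also have "\<dots> = Suc (card ((A \<inter> B \<inter> {1..p}) - {p}))"
          using AA True p by (intro card_Suc_Diff1[symmetric]) auto
        also have "card ((A \<inter> B \<inter> {1..p}) - {p}) \<le> card (A' \<inter> B)"
          using A finset AA by (intro card_mono) auto
        finally show ?thesis by simp
      qed
    qed
  qed
  ultimately have bound: "sum g (\<A> \<union> ?R') * sum h (\<B> - ?S) \<le> sum g \<A> * sum h \<B>"
    using opt unfolding optimal_pair_def by blast
  have inj: "inj_on (\<lambda>A. A - {p}) ?R"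
  proof (rule inj_onI)
    fix A B assume "A \<in> ?R" "B \<in> ?R" "A - {p} = B - {p}"
    then have "p \<in> A" "p \<in> B" "A - {p} = B - {p}" by (auto simp: critical_def)
    then show "A = B" by (metis insert_Diff)
  qed
  have finR: "finite ?R" using finA RA finite_subset by blast
  have split: "sum g (\<A> \<union> ?R') = sum g \<A> + sum g ?R'"
    by (rule sum.union_disjoint) (use finA finR disj in auto)
  have "lam * sum g ?R \<le> (\<Sum>A\<in>?R. g (A - {p}))"
    unfolding sum_distrib_left by (intro sum_mono W.drop_le) (auto simp: critical_def)
  also have "\<dots> = sum g ?R'" using inj by (simp add: sum.reindex)
  finally have "sum g \<A> + lam * sum g ?R \<le> sum g (\<A> \<union> ?R')" using split by simp
  moreover have eq: "sum h \<B> - sum h ?S = sum h (\<B> - ?S)" using finB SB by (simp add: sum_diff)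
  moreover have "0 \<le> sum h (\<B> - ?S)" by (simp add: sum_nonneg W'.nonneg)
  ultimately have "(sum g \<A> + lam * sum g ?R) * sum h (\<B> - ?S) \<le> sum g (\<A> \<union> ?R') * sum h (\<B> - ?S)"
    by (intro mult_right_mono)
  then show ?thesis using bound eq by simp
qed

text \<open>Here \<open>r/a\<close> and \<open>s/b\<close> are the shares of the critical sets. The two hypotheses say
  \<open>lam r b \<le> a s + lam r s\<close> and \<open>lam a s \<le> r b + lam r s\<close>; the one whose left-hand
  side is larger bounds both \<open>r b\<close> and \<open>a s\<close> by a multiple of \<open>r s\<close>.\<close>

lemma both_fractions_large:
  fixes a b r s lam :: real
  assumes "(a + lam * r) * (b - s) \<le> a * b" "(b + lam * s) * (a - r) \<le> b * a"
    and "0 < r" "0 < s" "0 < a" "0 < b" "1 < lam"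
  shows "(lam - 1) * a \<le> lam * r" and "(lam - 1) * b \<le> lam * s"
proof -
  have 1: "lam * (r * b) \<le> a * s + lam * (r * s)" using assms(1) by (simp add: algebra_simps)
  have 2: "lam * (a * s) \<le> r * b + lam * (r * s)" using assms(2) by (simp add: algebra_simps)
  have 3: "(lam - 1) * (a * s) \<le> lam * (r * s)" "(lam - 1) * (r * b) \<le> lam * (r * s)"
  proof -
    have "(lam - 1) * (a * s) \<le> lam * (r * s) \<and> (lam - 1) * (r * b) \<le> lam * (r * s)"
    proof (cases "a * s \<le> r * b")
      case True
      then have "(lam - 1) * (r * b) \<le> lam * (r * s)" using 1 by (simp add: algebra_simps)
      moreover have "(lam - 1) * (a * s) \<le> (lam - 1) * (r * b)" using True assms by (intro mult_left_mono) auto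
      ultimately show ?thesis by linarith
    next
      case False
      then have "(lam - 1) * (a * s) \<le> lam * (r * s)" using 2 by (simp add: algebra_simps)
      moreover have "(lam - 1) * (r * b) \<le> (lam - 1) * (a * s)" using False assms by (intro mult_left_mono) auto
      ultimately show ?thesis by linarith
    qed
    then show "(lam - 1) * (a * s) \<le> lam * (r * s)" "(lam - 1) * (r * b) \<le> lam * (r * s)" by auto
  qed
  have "((lam - 1) * a) * s \<le> (lam * r) * s" using 3(1) by (simp add: mult.assoc)
  then show "(lam - 1) * a \<le> lam * r" using assms(4) by simp
  have "((lam - 1) * b) * r \<le> (lam * s) * r" using 3(2) by (simp add: mult_ac)
  then show "(lam - 1) * b \<le> lam * s" using assms(3) by simp
qed

lemma level_bound:
  fixes a r lam :: real
  assumes "real p * r \<le> real i * a" "(lam - 1) * a \<le> lam * r" "0 < a" "1 < lam"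
  shows "real p * (lam - 1) \<le> real i * lam"
proof -
  have "(real p * (lam - 1)) * a = real p * ((lam - 1) * a)" by simp
  also have "\<dots> \<le> real p * (lam * r)" using assms by (intro mult_left_mono) auto
  also have "\<dots> = lam * (real p * r)" by simp
  also have "\<dots> \<le> lam * (real i * a)" using assms by (intro mult_left_mono) auto
  finally have "(real p * (lam - 1)) * a \<le> (real i * lam) * a" by (simp add: mult_ac)
  then show ?thesis using assms(3) by simp
qed

lemma critical_level_bounds:
  assumes W: "shift_weight m lam g" and W': "shift_weight n lam h" and opt: "optimal_pair t g h \<A> \<B>"
    and st: "stable \<A>" "stable \<B>" and p: "1 \<le> p" "1 \<le> t"
    and common: "\<And>A B. A \<in> \<A> \<Longrightarrow> B \<in> \<B> \<Longrightarrow> t \<le> card (A \<inter> B \<inter> {1..p})"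
    and AB: "A1 \<in> \<A>" "B1 \<in> \<B>" "p \<in> A1" "p \<in> B1" "card (A1 \<inter> B1 \<inter> {1..p}) = t"
  shows "real p * (lam - 1) \<le> real (card (A1 \<inter> {1..p})) * lam"
    and "real p * (lam - 1) \<le> real (card (B1 \<inter> {1..p})) * lam"
proof -
  interpret W: shift_weight m lam g by fact
  interpret W': shift_weight n lam h by fact
  define i j where "i = card (A1 \<inter> {1..p})" and "j = card (B1 \<inter> {1..p})"
  let ?R = "critical t p i \<A> \<B>" and ?S = "critical t p j \<B> \<A>"
  have ij: "i + j = p + t" unfolding i_def j_def
    by (rule critical_union(2)[OF st(1) common]) (use AB p in auto)
  have common': "t \<le> card (B \<inter> A \<inter> {1..p})" if "B \<in> \<B>" "A \<in> \<A>" for A B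
    using common[OF that(2,1)] by (simp add: Int_commute)
  have posA: "\<A> \<subseteq> {A. 0 < g A}" and posB: "\<B> \<subseteq> {B. 0 < h B}"
    using opt by (auto simp: optimal_pair_def)
  have finA: "finite \<A>" using posA W.finite_support finite_subset by blast
  have finB: "finite \<B>" using posB W'.finite_support finite_subset by blast
  have RA: "?R \<subseteq> \<A>" and SB: "?S \<subseteq> \<B>" by (auto simp: critical_def)
  have A1: "A1 \<in> ?R" and B1: "B1 \<in> ?S" using AB by (auto simp: critical_def i_def j_def Int_commute)
  have "0 < sum g ?R" by (rule sum_pos2[OF _ A1]) (use finA RA finite_subset AB posA W.nonneg in auto)
  moreover have "0 < sum h ?S" by (rule sum_pos2[OF _ B1]) (use finB SB finite_subset AB posB W'.nonneg in auto)
  moreover have a: "0 < sum g \<A>" by (rule sum_pos2[OF _ AB(1)]) (use finA AB posA W.nonneg in auto)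
  moreover have b: "0 < sum h \<B>" by (rule sum_pos2[OF _ AB(2)]) (use finB AB posB W'.nonneg in auto)
  moreover note alteration[OF W W' opt st(1) p ij common]
  moreover have "j + i = p + t" using ij by simp
  note alteration[OF W' W optimal_pair_sym[OF opt] st(2) p this common']
  moreover have lam: "1 < lam" using W.lam_gt by simp
  ultimately have f: "(lam - 1) * sum g \<A> \<le> lam * sum g ?R" "(lam - 1) * sum h \<B> \<le> lam * sum h ?S"
    using both_fractions_large[of "sum g \<A>" lam "sum g ?R" "sum h \<B>" "sum h ?S"] by auto
  have "real p * sum g ?R \<le> real i * sum g \<A>"
    by (rule W.critical_share[OF posA st(1) RA]) (auto simp: critical_def)
  from level_bound[OF this f(1) a lam]
  show "real p * (lam - 1) \<le> real (card (A1 \<inter> {1..p})) * lam" by (simp add: i_def)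
  have "real p * sum h ?S \<le> real j * sum h \<B>"
    by (rule W'.critical_share[OF posB st(2) SB]) (auto simp: critical_def)
  from level_bound[OF this f(2) b lam]
  show "real p * (lam - 1) \<le> real (card (B1 \<inter> {1..p})) * lam" by (simp add: j_def)
qed

context shift_weight begin

lemma star_weight_pos: "0 < g {1..t} \<Longrightarrow> 0 < star_weight t"
  unfolding star_weight_def
  by (rule sum_pos2[of _ "{1..t}"]) (use finite_support nonneg in \<open>auto simp: containing_def\<close>)

lemma base_trace_pos:
  assumes "0 < g {1..t}" "t \<le> p" shows "0 < trace_weight p {1..t}"
  unfolding trace_weight_def
proof (rule sum_pos2[of _ "{1..t}"])
  show "{1..t} \<in> {A \<in> Pow {1..m}. A \<inter> {1..p} = {1..t}}" using support[OF assms(1)] assms(2) by auto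
qed (use assms nonneg in simp_all)

end

text \<open>When \<open>p = t + 1\<close> and the first family has a critical member of size \<open>t\<close>, all
  members of the second family contain \<open>{1..t+1}\<close> and those of the first miss at most one point of it.
  Compared with the stars, the first weight grows at most by the factor \<open>t + 1\<close> and the second one
  shrinks at least by the factor \<open>lam + 1\<close>.\<close>

lemma product_bound_Suc:
  assumes W: "shift_weight m lam g" and W': "shift_weight n lam h"
    and pos: "\<A> \<subseteq> {A. 0 < g A}" "\<B> \<subseteq> {B. 0 < h B}"
    and st: "stable \<A>" and t: "real t \<le> lam"
    and base: "0 < g {1..t}" "0 < h {1..t}"
    and common: "\<And>A B. A \<in> \<A> \<Longrightarrow> B \<in> \<B> \<Longrightarrow> t \<le> card (A \<inter> B \<inter> {1..t+1})"
    and A1: "A1 \<in> \<A>" "t+1 \<in> A1" "card (A1 \<inter> {1..t+1}) = t" and "\<B> \<noteq> {}"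
  shows "sum g \<A> * sum h \<B> \<le> shift_weight.star_weight g t * shift_weight.star_weight h t"
    and "real t < lam \<Longrightarrow> sum g \<A> * sum h \<B> < shift_weight.star_weight g t * shift_weight.star_weight h t"
proof -
  interpret W: shift_weight m lam g by fact
  interpret W': shift_weight n lam h by fact
  let ?p = "t+1"
  obtain x where x: "x \<in> {1..?p}" "A1 \<inter> {1..?p} = {1..?p} - {x}"
    by (rule missing_one[of "A1 \<inter> {1..?p}" ?p]) (use A1(3) in simp_all)
  have "?p \<in> A1 \<inter> {1..?p}" using A1(2) by simp
  then have "?p \<noteq> x" using x(2) by blast
  then have xt: "x \<le> t" using x(1) by simp
  have xA: "x \<notin> A1" using x by blast
  have A2: "insert x (A1 - {?p}) \<in> \<A>"
    by (rule stableD[OF st A1(1) _ _ A1(2) xA]) (use x(1) xt in auto)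
  have full: "B \<inter> {1..?p} = {1..?p}" if B: "B \<in> \<B>" for B
  proof -
    have "{1..?p} - {x} \<subseteq> B"
    proof -
      have "t \<le> card (B \<inter> (A1 \<inter> {1..?p}))" using common[OF A1(1) B] by (simp add: Int_ac)
      then have "B \<inter> (A1 \<inter> {1..?p}) = A1 \<inter> {1..?p}" using A1(3) by (intro card_seteq) auto
      then show ?thesis using x(2) by blast
    qed
    moreover have "{1..t} \<subseteq> B"
    proof -
      have "insert x (A1 - {?p}) \<inter> {1..?p} = insert x ((A1 \<inter> {1..?p}) - {?p})" using x(1) by blast
      also have "\<dots> = insert x ({1..?p} - {x} - {?p})" unfolding x(2) ..
      also have "\<dots> = {1..t}" using x(1) xt by auto
      finally have e: "insert x (A1 - {?p}) \<inter> {1..?p} = {1..t}" .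
      have "t \<le> card (B \<inter> (insert x (A1 - {?p}) \<inter> {1..?p}))" using common[OF A2 B] by (simp add: Int_ac)
      then have "t \<le> card (B \<inter> {1..t})" using e by simp
      then have "B \<inter> {1..t} = {1..t}" by (intro card_seteq) auto
      then show ?thesis by auto
    qed
    moreover have "{1..?p} \<subseteq> ({1..?p} - {x}) \<union> {1..t}" using xt x(1) by auto
    ultimately show ?thesis by blast
  qed
  have tA: "?p \<le> card (A \<inter> {1..?p}) + 1" if "A \<in> \<A>" for A
  proof -
    obtain B where B: "B \<in> \<B>" using \<open>\<B> \<noteq> {}\<close> by auto
    have "A \<inter> B \<inter> {1..?p} = A \<inter> {1..?p}" using full[OF B] by blast
    then show ?thesis using common[OF that B] by simp
  qed
  define X Y x' y' where "X = W.trace_weight ?p {1..?p}" and "Y = W.trace_weight ?p {1..t}"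
    and "x' = W'.trace_weight ?p {1..?p}" and "y' = W'.trace_weight ?p {1..t}"
  have pt: "{1..?p} - {?p} = {1..t}" by auto
  have a: "sum g \<A> \<le> X + (real t + 1) * Y"
  proof -
    have "sum g \<A> \<le> X + (\<Sum>x\<in>{1..?p}. W.trace_weight ?p ({1..?p} - {x}))"
      unfolding X_def by (rule W.near_full_weight[OF pos(1) tA])
    also have "(\<Sum>x\<in>{1..?p}. W.trace_weight ?p ({1..?p} - {x})) \<le> (\<Sum>x\<in>{1..?p}. Y)"
      unfolding Y_def pt[symmetric] by (intro sum_mono W.trace_weight_missing_mono) auto
    finally show ?thesis by (simp add: algebra_simps)
  qed
  have b: "sum h \<B> \<le> x'"
    using W'.sum_le_traces[OF pos(2), of ?p "{{1..?p}}"] full by (simp add: x'_def)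
  have sg: "W.star_weight t = Y + X" unfolding X_def Y_def by (rule W.star_weight_Suc)
  have sh: "W'.star_weight t = y' + x'" unfolding x'_def y'_def by (rule W'.star_weight_Suc)
  have y': "lam * x' \<le> y'" using W'.trace_weight_drop[of ?p "{1..?p}" ?p] pt unfolding x'_def y'_def by simp
  have nn: "0 \<le> X" "0 < Y" "0 \<le> x'" "0 < y'"
    using W.trace_weight_nonneg W'.trace_weight_nonneg W.base_trace_pos W'.base_trace_pos base
    by (auto simp: X_def Y_def x'_def y'_def)
  have p1: "sum g \<A> * sum h \<B> \<le> (X + (real t + 1) * Y) * x'"
    using a b nn by (intro mult_mono) (auto simp: sum_nonneg W'.nonneg)
  have p2: "(Y + X) * ((lam + 1) * x') \<le> (Y + X) * (y' + x')"
    using y' nn by (intro mult_left_mono) (auto simp: algebra_simps)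
  have "(X + (real t + 1) * Y) * x' \<le> ((Y + X) * (lam + 1)) * x'"
  proof (rule mult_right_mono)
    have "(real t + 1) * Y \<le> (lam + 1) * Y" "X \<le> (lam + 1) * X"
      using nn t W.lam_gt by (auto intro!: mult_right_mono simp: algebra_simps)
    then show "X + (real t + 1) * Y \<le> (Y + X) * (lam + 1)" by (simp add: algebra_simps)
  qed (use nn in simp)
  then show "sum g \<A> * sum h \<B> \<le> W.star_weight t * W'.star_weight t"
    unfolding sg sh using p1 p2 by (simp add: mult.assoc)
  show "sum g \<A> * sum h \<B> < W.star_weight t * W'.star_weight t" if tl: "real t < lam"
  proof (cases "x' = 0")
    case True
    then have "sum g \<A> * sum h \<B> \<le> 0" using p1 by simp
    also have "0 < W.star_weight t * W'.star_weight t" unfolding sg sh using nn by simp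
    finally show ?thesis .
  next
    case False
    have "(X + (real t + 1) * Y) * x' < ((Y + X) * (lam + 1)) * x'"
    proof (rule mult_strict_right_mono)
      have "(real t + 1) * Y < (lam + 1) * Y" using nn tl by (intro mult_strict_right_mono) auto
      moreover have "X \<le> (lam + 1) * X" using nn W.lam_gt by (auto simp: algebra_simps)
      ultimately show "X + (real t + 1) * Y < (Y + X) * (lam + 1)" by (simp add: algebra_simps)
    qed (use nn False in simp)
    then show ?thesis unfolding sg sh using p1 p2 by (simp add: mult.assoc)
  qed
qed

section \<open>Direct comparison with stars\<close>

context shift_weight begin

text \<open>Passing from the star of \<open>{1..t}\<close> to the sets that miss at most one point of \<open>{1..t+2}\<close>
  one loses the trace \<open>{1..t}\<close> and gains \<open>t\<close> traces of size \<open>t + 1\<close>, none of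
  them heavier than the one whose gap is \<open>t + 1\<close>.\<close>

lemma near_full_star_weight:
  assumes "\<A> \<subseteq> {A. 0 < g A}" "\<And>A. A \<in> \<A> \<Longrightarrow> t + 1 \<le> card (A \<inter> {1..t+2})"
  shows "sum g \<A> + trace_weight (t+2) {1..t}
    \<le> star_weight t + real t * trace_weight (t+2) ({1..t+2} - {t+1})"
proof -
  let ?p = "t+2"
  have "sum g \<A> \<le> trace_weight ?p {1..?p} + (\<Sum>x\<in>{1..?p}. trace_weight ?p ({1..?p} - {x}))"
    by (rule near_full_weight[OF assms(1)]) (use assms(2) in fastforce)
  also have "(\<Sum>x\<in>{1..?p}. trace_weight ?p ({1..?p} - {x}))
      = (\<Sum>x\<in>{1..t+1}. trace_weight ?p ({1..?p} - {x})) + trace_weight ?p ({1..?p} - {?p})"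
  proof -
    have "(\<Sum>x\<in>{1..?p}. f x) = (\<Sum>x\<in>{1..t+1}. f x) + f ?p" for f :: "nat \<Rightarrow> real" by simp
    then show ?thesis .
  qed
  also have "{1..?p} - {?p} = {1..t+1}" by auto
  also have "(\<Sum>x\<in>{1..t+1}. trace_weight ?p ({1..?p} - {x}))
      \<le> (\<Sum>x\<in>{1..t+1}. trace_weight ?p ({1..?p} - {t+1}))"
    by (intro sum_mono trace_weight_missing_mono) auto
  also have "\<dots> = (real t + 1) * trace_weight ?p ({1..?p} - {t+1})" by simp
  finally have "sum g \<A> \<le> trace_weight ?p {1..?p} +
      ((real t + 1) * trace_weight ?p ({1..?p} - {t+1}) + trace_weight ?p {1..t+1})" by simp
  then show ?thesis unfolding star_weight_Suc_Suc by (simp only: algebra_simps)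
qed

lemma second_trace_le: "lam * trace_weight (t+2) ({1..t+2} - {t+1}) \<le> trace_weight (t+2) {1..t}"
proof -
  have "{1..t+2} - {t+1} - {t+2} = {1..t}" by auto
  then show ?thesis using trace_weight_drop[of "t+2" "{1..t+2} - {t+1}" "t+2"] by simp
qed

text \<open>For \<open>lam > 8/3\<close> the trace \<open>{1..t}\<close> on \<open>{1..t+2}\<close> carries more than half of
  the star: the other three traces have weight at most \<open>1/lam\<close>, \<open>1/lam\<close> and
  \<open>1/lam\<^sup>2\<close> times as much, and \<open>3/8 + 3/8 + 9/64 < 1\<close>.\<close>

lemma star_weight_le_base:
  assumes "8/3 < lam" "0 < g {1..t}"
  shows "star_weight t < 2 * trace_weight (t+2) {1..t}"
proof -
  define W Y Y' Z where "W = trace_weight (t+2) {1..t}" and "Y = trace_weight (t+2) {1..t+1}"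
    and "Y' = trace_weight (t+2) ({1..t+2} - {t+1})" and "Z = trace_weight (t+2) {1..t+2}"
  have "{1..t+1} - {t+1} = {1..t}" "{1..t+2} - {t+2} = {1..t+1}" by auto
  then have "lam * Y \<le> W" "lam * Z \<le> Y" "lam * Y' \<le> W"
    using trace_weight_drop[of "t+1" "{1..t+1}" "t+2"] trace_weight_drop[of "t+2" "{1..t+2}" "t+2"]
      second_trace_le[of t] unfolding W_def Y_def Z_def Y'_def by simp_all
  moreover have "8/3 * trace_weight p Q \<le> lam * trace_weight p Q" for p Q
    using assms(1) trace_weight_nonneg by (intro mult_right_mono) auto
  then have "8/3 * Y \<le> lam * Y" "8/3 * Z \<le> lam * Z" "8/3 * Y' \<le> lam * Y'"
    unfolding Y_def Z_def Y'_def by blast+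
  moreover have "0 < W" unfolding W_def by (rule base_trace_pos) (use assms in auto)
  ultimately show ?thesis unfolding star_weight_Suc_Suc W_def[symmetric] Y_def[symmetric]
      Y'_def[symmetric] Z_def[symmetric] by linarith
qed

lemma near_full_le_star:
  assumes "\<A> \<subseteq> {A. 0 < g A}" "\<And>A. A \<in> \<A> \<Longrightarrow> t + 1 \<le> card (A \<inter> {1..t+2})" "real t \<le> lam"
  shows "sum g \<A> \<le> star_weight t"
    and "real t < lam \<Longrightarrow> 0 < g {1..t} \<Longrightarrow> sum g \<A> < star_weight t"
proof -
  let ?Y = "trace_weight (t+2) ({1..t+2} - {t+1})" and ?W = "trace_weight (t+2) {1..t}"
  have "real t * ?Y \<le> lam * ?Y" using assms(3) trace_weight_nonneg by (intro mult_right_mono)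
  then show "sum g \<A> \<le> star_weight t"
    using near_full_star_weight[OF assms(1,2)] second_trace_le[of t] by linarith
  show "sum g \<A> < star_weight t" if "real t < lam" "0 < g {1..t}"
  proof -
    have "real t * ?Y < ?W"
    proof (cases "?Y = 0")
      case True
      then show ?thesis using base_trace_pos[of t "t+2"] that by simp
    next
      case False
      then have "0 < ?Y" using trace_weight_nonneg[of "t+2" "{1..t+2} - {t+1}"] by linarith
      then have "real t * ?Y < lam * ?Y" using that by (intro mult_strict_right_mono)
      then show ?thesis using second_trace_le[of t] by linarith
    qed
    then show ?thesis using near_full_star_weight[OF assms(1,2)] by linarith
  qed
qed

lemma support_subset:
  assumes "0 < g F" "T \<subseteq> F" shows "0 < g T"
proof -
  have "finite (F - T)" using support[OF assms(1)] by (meson finite_Diff finite_atLeastAtMost finite_subset)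
  then have "0 < g (F - D)" if "D \<subseteq> F - T" for D
    using that
  proof (induction D rule: infinite_finite_induct)
    case (infinite D)
    then show ?case using finite_subset by blast
  next
    case empty
    then show ?case using assms by simp
  next
    case (insert x D)
    then have "0 < g (F - D)" "x \<in> F - D" by auto
    then have "0 < lam * g (F - D)" "lam * g (F - D) \<le> g (F - D - {x})"
      using lam_gt drop_le[of x "F - D"] by auto
    moreover have "F - D - {x} = F - insert x D" by auto
    ultimately show ?case by simp
  qed
  from this[of "F - T"] show ?thesis using assms(2) by (simp add: double_diff)
qed

end

text \<open>A member of the second family with only \<open>t\<close> elements in \<open>{1..t+2}\<close> must have trace
  \<open>{1..t}\<close>, so all members of the first family contain \<open>{1..t}\<close>; and none has exactly that
  trace, because \<open>B1\<close> misses a point of \<open>{1..t}\<close>. The first family then has less than half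
  of the weight of its star, while the second one has at most twice the weight of its star.\<close>

lemma product_bound_mixed:
  assumes W: "shift_weight m lam g" and W': "shift_weight n lam h"
    and pos: "\<A> \<subseteq> {A. 0 < g A}" "\<B> \<subseteq> {B. 0 < h B}"
    and st: "stable \<A>" and t: "real t \<le> lam" and lam: "8/3 < lam"
    and base: "0 < g {1..t}" "0 < h {1..t}"
    and common: "\<And>A B. A \<in> \<A> \<Longrightarrow> B \<in> \<B> \<Longrightarrow> t \<le> card (A \<inter> B \<inter> {1..t+2})"
    and A1: "A1 \<in> \<A>" "t+2 \<in> A1" "card (A1 \<inter> {1..t+2}) = t+1"
    and B1: "B1 \<in> \<B>" "t+2 \<in> B1" "card (B1 \<inter> {1..t+2}) = t+1"
    and AB: "card (A1 \<inter> B1 \<inter> {1..t+2}) = t"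
    and B0: "B0 \<in> \<B>" "card (B0 \<inter> {1..t+2}) = t"
  shows "sum g \<A> * sum h \<B> < shift_weight.star_weight g t * shift_weight.star_weight h t"
proof -
  interpret W: shift_weight m lam g by fact
  interpret W': shift_weight n lam h by fact
  let ?p = "t+2"
  obtain x where x: "x \<in> {1..?p}" "A1 \<inter> {1..?p} = {1..?p} - {x}"
    by (rule missing_one[of "A1 \<inter> {1..?p}" ?p]) (use A1(3) in simp_all)
  obtain x' where x': "x' \<in> {1..?p}" "B1 \<inter> {1..?p} = {1..?p} - {x'}"
    by (rule missing_one[of "B1 \<inter> {1..?p}" ?p]) (use B1(3) in simp_all)
  have pI: "?p \<in> A1 \<inter> {1..?p}" "?p \<in> B1 \<inter> {1..?p}" using A1(2) B1(2) by simp_all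
  have xp: "x \<noteq> ?p" "x' \<noteq> ?p" using pI x(2) x'(2) by blast+
  have xx': "x \<noteq> x'"
  proof
    assume "x = x'"
    then have "A1 \<inter> B1 \<inter> {1..?p} = A1 \<inter> {1..?p}" using x x' by blast
    then show False using AB A1(3) by simp
  qed
  \<comment> \<open>A trace of the minimal size \<open>t\<close> lies in every member of the other family; in particular in
    \<open>A1\<close> and in its shifts.\<close>
  have inside: "B \<inter> {1..?p} \<subseteq> A" if "A \<in> \<A>" "B \<in> \<B>" "card (B \<inter> {1..?p}) = t" for A B
  proof -
    have "A \<inter> B \<inter> {1..?p} = B \<inter> {1..?p}"
      using common[OF that(1,2)] that(3) by (intro card_seteq) auto
    then show ?thesis by blast
  qed
  have xA: "x \<notin> A1" using x by blast
  have A2: "insert x (A1 - {?p}) \<in> \<A>"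
    by (rule stableD[OF st A1(1) _ _ A1(2) xA]) (use x(1) xp in auto)
  have low: "B \<inter> {1..?p} \<subseteq> {1..t+1} - {x}" if "B \<in> \<B>" "card (B \<inter> {1..?p}) = t" for B
  proof -
    have "?p \<notin> insert x (A1 - {?p})" using xp by auto
    then have n: "?p \<notin> B \<inter> {1..?p}" "x \<notin> B \<inter> {1..?p}"
      using inside[OF A2 that] inside[OF A1(1) that] xA by blast+
    show ?thesis
    proof
      fix y assume y: "y \<in> B \<inter> {1..?p}"
      then have "y \<noteq> ?p" "y \<noteq> x" using n by blast+
      then show "y \<in> {1..t+1} - {x}" using y by auto
    qed
  qed
  have xt: "x = t+1"
  proof (rule ccontr)
    assume "x \<noteq> t+1"
    then have xt: "x \<le> t" "x \<in> {1..t}" using x(1) xp by auto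
    have "t+1 \<in> {1..?p} - {x}" using xt by auto
    then have "t+1 \<in> A1" using x by blast
    have "insert x (A1 - {t+1}) \<in> \<A>"
      by (rule stableD[OF st A1(1)]) (use xt \<open>t+1 \<in> A1\<close> xA in auto)
    then have "t+1 \<notin> B0" using inside[OF _ B0, of "insert x (A1 - {t+1})"] xt by auto
    then have "B0 \<inter> {1..?p} \<subseteq> {1..t+1} - {x} - {t+1}" using low[OF B0] by blast
    also have "\<dots> = {1..t} - {x}" by auto
    finally have "card (B0 \<inter> {1..?p}) \<le> card ({1..t} - {x})" by (intro card_mono) auto
    also have "\<dots> < card {1..t}" using xt(2) by (intro card_Diff1_less) auto
    finally show False using B0 by simp
  qed
  have e1: "{1..t+1} - {t+1} = {1..t}" by auto
  have small: "B \<inter> {1..?p} = {1..t}" if "B \<in> \<B>" "card (B \<inter> {1..?p}) = t" for B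
    using low[OF that] that(2) unfolding xt e1 by (intro card_seteq) auto
  have B0t: "B0 \<inter> {1..?p} = {1..t}" by (rule small[OF B0])
  have x't: "x' \<in> {1..t}" using x'(1) xp xx' xt by auto
  have contA: "{1..t} \<subseteq> A" if "A \<in> \<A>" for A
    using inside[OF that B0] B0t by blast
  have notA: "A \<inter> {1..?p} \<noteq> {1..t}" if "A \<in> \<A>" for A
  proof
    assume "A \<inter> {1..?p} = {1..t}"
    then have "A \<inter> B1 \<inter> {1..?p} \<subseteq> {1..t} - {x'}" using x'(2) by blast
    then have "card (A \<inter> B1 \<inter> {1..?p}) \<le> card ({1..t} - {x'})" by (intro card_mono) auto
    also have "\<dots> < card {1..t}" using x't by (intro card_Diff1_less) auto
    finally show False using common[OF that B1(1)] by simp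
  qed
  have fin: "finite {Q. {1..t} \<subseteq> Q \<and> Q \<subseteq> {1..?p}}" by (rule finite_subset[of _ "Pow {1..?p}"]) auto
  have "sum g \<A> \<le> sum (W.trace_weight ?p) ({Q. {1..t} \<subseteq> Q \<and> Q \<subseteq> {1..?p}} - {{1..t}})"
  proof (rule W.sum_le_traces[OF pos(1)])
    have "{1..t} \<subseteq> {1..?p}" by auto
    then show "A \<inter> {1..?p} \<in> {Q. {1..t} \<subseteq> Q \<and> Q \<subseteq> {1..?p}} - {{1..t}}" if "A \<in> \<A>" for A
      using contA[OF that] notA[OF that] by blast
  qed (use fin in simp)
  also have "\<dots> = W.star_weight t - W.trace_weight ?p {1..t}"
    using W.star_weight_traces[of t ?p] fin by (subst sum_diff1) auto
  finally have a: "2 * sum g \<A> < W.star_weight t"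
    using W.star_weight_le_base[OF lam base(1)] by linarith
  have b: "sum h \<B> \<le> 2 * W'.star_weight t"
  proof -
    let ?L = "{B \<in> \<B>. t + 1 \<le> card (B \<inter> {1..?p})}"
    have finB: "finite \<B>" using pos W'.finite_support finite_subset by blast
    have "sum h \<B> = sum h ?L + sum h (\<B> - ?L)" 
      using sum.subset_diff[of ?L \<B> h] finB by simp
    moreover have "sum h (\<B> - ?L) \<le> W'.trace_weight ?p {1..t}"
    proof -
      have "sum h (\<B> - ?L) \<le> sum (W'.trace_weight ?p) {{1..t}}"
      proof (rule W'.sum_le_traces)
      fix B assume B: "B \<in> \<B> - ?L"
      have "t \<le> card (A1 \<inter> B \<inter> {1..?p})" using common A1 B by auto
      also have "\<dots> \<le> card (B \<inter> {1..?p})" by (intro card_mono) auto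
      finally have "card (B \<inter> {1..?p}) = t" using B by auto
      then show "B \<inter> {1..?p} \<in> {{1..t}}" using small B by auto
      qed (use pos in auto)
      then show ?thesis by simp
    qed
    moreover have "sum h ?L + W'.trace_weight ?p {1..t}
        \<le> W'.star_weight t + real t * W'.trace_weight ?p ({1..?p} - {t+1})"
      by (rule W'.near_full_star_weight) (use pos in auto)
    moreover have "real t * W'.trace_weight ?p ({1..?p} - {t+1}) \<le> lam * W'.trace_weight ?p ({1..?p} - {t+1})"
      using t W'.trace_weight_nonneg by (intro mult_right_mono)
    moreover have "lam * W'.trace_weight ?p ({1..?p} - {t+1}) \<le> W'.trace_weight ?p {1..t}"
      by (rule W'.second_trace_le)
    moreover have "W'.trace_weight ?p {1..t} \<le> W'.star_weight t"
      unfolding W'.star_weight_Suc_Suc using W'.trace_weight_nonneg by (simp add: add_nonneg_nonneg)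
    ultimately show ?thesis by linarith
  qed
  have "sum g \<A> * sum h \<B> \<le> sum g \<A> * (2 * W'.star_weight t)"
    using b by (intro mult_left_mono) (auto simp: sum_nonneg W.nonneg)
  also have "\<dots> = (2 * sum g \<A>) * W'.star_weight t" by simp
  also have "\<dots> < W.star_weight t * W'.star_weight t"
    using a W'.star_weight_pos[OF base(2)] by (intro mult_strict_right_mono)
  finally show ?thesis .
qed

text \<open>Apart from the mixed situation, all members of both families miss at most one point of \<open>{1..t+2}\<close>,
  and such a family is never heavier than the star.\<close>

lemma product_bound_Suc_Suc:
  assumes W: "shift_weight m lam g" and W': "shift_weight n lam h"
    and pos: "\<A> \<subseteq> {A. 0 < g A}" "\<B> \<subseteq> {B. 0 < h B}"
    and st: "stable \<A>" "stable \<B>" and t: "real t \<le> lam" and lam: "8/3 < lam"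
    and base: "0 < g {1..t}" "0 < h {1..t}"
    and common: "\<And>A B. A \<in> \<A> \<Longrightarrow> B \<in> \<B> \<Longrightarrow> t \<le> card (A \<inter> B \<inter> {1..t+2})"
    and A1: "A1 \<in> \<A>" "t+2 \<in> A1" "card (A1 \<inter> {1..t+2}) = t+1"
    and B1: "B1 \<in> \<B>" "t+2 \<in> B1" "card (B1 \<inter> {1..t+2}) = t+1"
    and AB: "card (A1 \<inter> B1 \<inter> {1..t+2}) = t"
  shows "sum g \<A> * sum h \<B> \<le> shift_weight.star_weight g t * shift_weight.star_weight h t"
    and "real t < lam \<Longrightarrow> sum g \<A> * sum h \<B> < shift_weight.star_weight g t * shift_weight.star_weight h t"
proof -
  interpret W: shift_weight m lam g by fact
  interpret W': shift_weight n lam h by fact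
  let ?p = "t+2"
  have common': "t \<le> card (B \<inter> A \<inter> {1..?p})" if "B \<in> \<B>" "A \<in> \<A>" for A B
    using common[OF that(2,1)] by (simp add: Int_commute)
  have AB': "card (B1 \<inter> A1 \<inter> {1..?p}) = t" using AB by (simp add: Int_commute)
  have sA: "t \<le> card (A \<inter> {1..?p})" if "A \<in> \<A>" for A
    using common[OF that B1(1)] card_mono[of "A \<inter> {1..?p}" "A \<inter> B1 \<inter> {1..?p}"] by fastforce
  have sB: "t \<le> card (B \<inter> {1..?p})" if "B \<in> \<B>" for B
    using common[OF A1(1) that] card_mono[of "B \<inter> {1..?p}" "A1 \<inter> B \<inter> {1..?p}"] by fastforce
  consider B0 where "B0 \<in> \<B>" "card (B0 \<inter> {1..?p}) = t" | A0 where "A0 \<in> \<A>" "card (A0 \<inter> {1..?p}) = t"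
    | "\<And>A. A \<in> \<A> \<Longrightarrow> t + 1 \<le> card (A \<inter> {1..?p})" "\<And>B. B \<in> \<B> \<Longrightarrow> t + 1 \<le> card (B \<inter> {1..?p})"
    using sA sB by (metis Suc_eq_plus1 Suc_leI order_le_less)
  then have "sum g \<A> * sum h \<B> \<le> W.star_weight t * W'.star_weight t \<and>
      (real t < lam \<longrightarrow> sum g \<A> * sum h \<B> < W.star_weight t * W'.star_weight t)"
  proof cases
    case (1 B0)
    then show ?thesis
      using product_bound_mixed[OF W W' pos st(1) t lam base common A1 B1 AB] by fastforce
  next
    case (2 A0)
    then have "sum h \<B> * sum g \<A> < W'.star_weight t * W.star_weight t"
      by (intro product_bound_mixed[OF W' W pos(2,1) st(2) t lam base(2,1) common' B1 A1 AB'])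
    then show ?thesis by (simp add: mult.commute)
  next
    case 3
    have n: "0 \<le> sum h \<B>" "0 \<le> sum g \<A>" by (simp_all add: sum_nonneg W.nonneg W'.nonneg)
    have a: "sum g \<A> \<le> W.star_weight t" by (rule W.near_full_le_star(1)[OF pos(1) _ t]) (rule 3(1))
    have b: "sum h \<B> \<le> W'.star_weight t" by (rule W'.near_full_le_star(1)[OF pos(2) _ t]) (rule 3(2))
    have "sum g \<A> * sum h \<B> \<le> W.star_weight t * W'.star_weight t"
      by (rule mult_mono) (use a b n in linarith)+
    moreover have "sum g \<A> * sum h \<B> < W.star_weight t * W'.star_weight t" if tl: "real t < lam"
    proof (rule mult_strict_mono'[OF _ _ n(2,1)])
      show "sum g \<A> < W.star_weight t"
        by (rule W.near_full_le_star(2)[OF pos(1) _ t tl base(1)]) (rule 3(1))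
      show "sum h \<B> < W'.star_weight t"
        by (rule W'.near_full_le_star(2)[OF pos(2) _ t tl base(2)]) (rule 3(2))
    qed
    ultimately show ?thesis by blast
  qed
  then show "sum g \<A> * sum h \<B> \<le> W.star_weight t * W'.star_weight t"
    and "real t < lam \<Longrightarrow> sum g \<A> * sum h \<B> < W.star_weight t * W'.star_weight t" by auto
qed

section \<open>The weighted cross-t-intersection theorem\<close>

lemma (in shift_weight) sum_subset_eqI:
  assumes "\<A> \<subseteq> \<F>" "\<F> \<subseteq> {A. 0 < g A}" "sum g \<F> \<le> sum g \<A>"
  shows "\<A> = \<F>"
proof (rule ccontr)
  assume "\<A> \<noteq> \<F>"
  then obtain A where A: "A \<in> \<F> - \<A>" using assms(1) by blast
  have "sum g \<A> < sum g \<F>"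
    by (rule sum_strict_mono2[of _ _ A])
      (use assms A finite_support finite_subset nonneg in auto)
  then show False using assms(3) by simp
qed

lemma optimal_pair_ge_star:
  assumes W: "shift_weight m lam g" and opt: "optimal_pair t g h \<A> \<B>"
  shows "shift_weight.star_weight g t * sum h (containing {B. 0 < h B} {1..t}) \<le> sum g \<A> * sum h \<B>"
proof -
  interpret W: shift_weight m lam g by fact
  have "cross_intersecting t (containing {A. 0 < g A} {1..t}) (containing {B. 0 < h B} {1..t})"
    by (rule cross_intersecting_containing) (use W.finite_in_support in auto)
  moreover have "containing {A. 0 < g A} {1..t} \<subseteq> {A. 0 < g A}" "containing {B. 0 < h B} {1..t} \<subseteq> {B. 0 < h B}"
    by (auto simp: containing_def)
  ultimately show ?thesis using opt unfolding optimal_pair_def W.star_weight_def by blast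
qed

lemma two_product_eq:
  fixes a b a0 b0 :: "'a :: linordered_semidom"
  assumes "a \<le> a0" "b \<le> b0" "0 \<le> a" "0 \<le> b" "0 < a0" "0 < b0" "a0 * b0 \<le> a * b"
  shows "a0 \<le> a" and "b0 \<le> b"
proof -
  show "a0 \<le> a"
  proof (rule ccontr)
    assume "\<not> a0 \<le> a"
    then have "a * b \<le> a * b0" "a * b0 < a0 * b0" using assms
      by (auto intro: mult_left_mono mult_strict_right_mono)
    then show False using assms(7) by (meson le_less_trans not_le)
  qed
  show "b0 \<le> b"
  proof (rule ccontr)
    assume "\<not> b0 \<le> b"
    then have "a * b \<le> a0 * b" "a0 * b < a0 * b0" using assms
      by (auto intro: mult_right_mono mult_strict_left_mono)
    then show False using assms(7) by (meson le_less_trans not_le)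
  qed
qed

text \<open>The critical sizes \<open>i\<close> and \<open>j\<close> satisfy \<open>p (lam - 1) \<le> i lam\<close> and
  \<open>p (lam - 1) \<le> j lam\<close>, where \<open>i + j = p + t\<close>. This excludes \<open>p \<ge> t + 3\<close>, and
  for \<open>p = t + 2\<close> it excludes \<open>i = t\<close> and \<open>j = t\<close>.\<close>

lemma stable_optimal_pair:
  assumes W: "shift_weight m lam g" and W': "shift_weight n lam h" and opt: "optimal_pair t g h \<A> \<B>"
    and st: "stable \<A>" "stable \<B>" and t: "1 \<le> t" "real t \<le> lam" and lam: "2 * real t < 3 * (lam - 2)"
    and base: "0 < g {1..t}" "0 < h {1..t}"
  shows "sum g \<A> * sum h \<B> \<le> shift_weight.star_weight g t * shift_weight.star_weight h t \<and>
    (real t < lam \<longrightarrow> \<A> = containing {A. 0 < g A} {1..t} \<and> \<B> = containing {B. 0 < h B} {1..t})"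
proof -
  interpret W: shift_weight m lam g by fact
  interpret W': shift_weight n lam h by fact
  have pos: "\<A> \<subseteq> {A. 0 < g A}" "\<B> \<subseteq> {B. 0 < h B}" and cross: "cross_intersecting t \<A> \<B>"
    using opt by (auto simp: optimal_pair_def)
  have spos: "0 < W.star_weight t" "0 < W'.star_weight t"
    using base W.star_weight_pos W'.star_weight_pos by auto
  have ge: "W.star_weight t * W'.star_weight t \<le> sum g \<A> * sum h \<B>"
    using optimal_pair_ge_star[OF W opt] by (simp add: W'.star_weight_def)
  moreover have "0 < W.star_weight t * W'.star_weight t" using spos by simp
  ultimately have ne: "\<A> \<noteq> {}" "\<B> \<noteq> {}" by auto
  let ?P = "\<lambda>p. \<forall>A\<in>\<A>. \<forall>B\<in>\<B>. t \<le> card (A \<inter> B \<inter> {1..p})"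
  define p where "p = (LEAST p. ?P p)"
  have "?P m"
  proof (intro ballI)
    fix A B assume AB: "A \<in> \<A>" "B \<in> \<B>"
    then have "A \<inter> B \<inter> {1..m} = A \<inter> B" using pos W.support[of A] by blast
    then show "t \<le> card (A \<inter> B \<inter> {1..m})" using cross AB by (simp add: cross_intersecting_def)
  qed
  then have "?P p" unfolding p_def by (rule LeastI)
  then have common: "t \<le> card (A \<inter> B \<inter> {1..p})" if "A \<in> \<A>" "B \<in> \<B>" for A B using that by blast
  have common': "t \<le> card (B \<inter> A \<inter> {1..p})" if "B \<in> \<B>" "A \<in> \<A>" for A B
    using common[OF that(2,1)] by (simp add: Int_commute)
  have "t \<le> p"
  proof -
    obtain A B where "A \<in> \<A>" "B \<in> \<B>" using ne by auto
    then have "t \<le> card (A \<inter> B \<inter> {1..p})" by (rule common)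
    also have "\<dots> \<le> card {1..p}" by (intro card_mono) auto
    finally show ?thesis by simp
  qed
  show ?thesis
  proof (cases "p = t")
    case True
    have in_star: "{1..t} \<subseteq> A \<inter> B" if "A \<in> \<A>" "B \<in> \<B>" for A B
    proof -
      have "A \<inter> B \<inter> {1..t} = {1..t}" using common[OF that] True by (intro card_seteq) auto
      then show ?thesis by blast
    qed
    have sub: "\<A> \<subseteq> containing {A. 0 < g A} {1..t}" "\<B> \<subseteq> containing {B. 0 < h B} {1..t}"
      using in_star ne pos unfolding containing_def by blast+
    have le: "sum g \<A> \<le> W.star_weight t" "sum h \<B> \<le> W'.star_weight t"
      unfolding W.star_weight_def W'.star_weight_def
      by (rule sum_mono2; use sub W.finite_support W'.finite_support W.nonneg W'.nonneg in
          \<open>auto simp: containing_def\<close>)+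
    have nn: "0 \<le> sum g \<A>" "0 \<le> sum h \<B>" by (simp_all add: sum_nonneg W.nonneg W'.nonneg)
    note eq = two_product_eq[OF le nn spos ge]
    have "\<A> = containing {A. 0 < g A} {1..t}"
      by (rule W.sum_subset_eqI[OF sub(1)]) (use eq(1) in \<open>auto simp: W.star_weight_def containing_def\<close>)
    moreover have "\<B> = containing {B. 0 < h B} {1..t}"
      by (rule W'.sum_subset_eqI[OF sub(2)]) (use eq(2) in \<open>auto simp: W'.star_weight_def containing_def\<close>)
    moreover have "sum g \<A> * sum h \<B> \<le> W.star_weight t * W'.star_weight t"
      by (rule mult_mono) (use le nn spos in linarith)+
    ultimately show ?thesis by blast
  next
    case False
    then have "t < p" using \<open>t \<le> p\<close> by simp
    then have p1: "1 \<le> p" by simp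
    have "\<not> ?P (p - 1)" using p1 not_less_Least[of "p - 1" ?P] unfolding p_def[symmetric] by simp
    then obtain A1 B1 where AB: "A1 \<in> \<A>" "B1 \<in> \<B>" and less: "card (A1 \<inter> B1 \<inter> {1..p-1}) < t"
      by (auto simp: not_le)
    have ins: "{1..p} = insert p {1..p-1}" using p1 by auto
    have pAB: "p \<in> A1 \<inter> B1"
    proof (rule ccontr)
      assume "p \<notin> A1 \<inter> B1"
      then have "A1 \<inter> B1 \<inter> {1..p} = A1 \<inter> B1 \<inter> {1..p-1}" unfolding ins by blast
      then show False using common[OF AB] less by simp
    qed
    then have pA: "p \<in> A1" and pB: "p \<in> B1" by auto
    have "A1 \<inter> B1 \<inter> {1..p} = insert p (A1 \<inter> B1 \<inter> {1..p-1})" unfolding ins using pAB by blast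
    then have "card (A1 \<inter> B1 \<inter> {1..p}) \<le> Suc (card (A1 \<inter> B1 \<inter> {1..p-1}))"
      by (simp add: card_insert_le_m1)
    then have ct: "card (A1 \<inter> B1 \<inter> {1..p}) = t" using common[OF AB] less by simp
    then have ct': "card (B1 \<inter> A1 \<inter> {1..p}) = t" by (simp add: Int_commute)
    define i j where "i = card (A1 \<inter> {1..p})" and "j = card (B1 \<inter> {1..p})"
    have ij: "i + j = p + t" unfolding i_def j_def
      by (rule critical_union(2)[OF st(1) common AB pA pB ct p1])
    have levi: "real p * (lam - 1) \<le> real i * lam" unfolding i_def
      by (rule critical_level_bounds(1)[OF W W' opt st p1 t(1) common AB pA pB ct])
    have levj: "real p * (lam - 1) \<le> real j * lam" unfolding j_def
      by (rule critical_level_bounds(2)[OF W W' opt st p1 t(1) common AB pA pB ct])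
    have it: "t \<le> i" "t \<le> j"
      unfolding i_def j_def ct[symmetric] by (intro card_mono; blast)+
    have "p < t + 3"
    proof (rule ccontr)
      assume "\<not> p < t + 3"
      then have "(real t + 3) * (lam - 2) \<le> real p * (lam - 2)"
        using W.lam_gt by (intro mult_right_mono) auto
      moreover have "real i * lam + real j * lam = (real p + real t) * lam"
        using ij by (metis distrib_right of_nat_add)
      then have "real p * (lam - 2) \<le> real t * lam" using levi levj by (simp add: algebra_simps)
      ultimately show False using lam by (simp add: algebra_simps)
    qed
    then consider "p = t + 1" "i = t" | "p = t + 1" "j = t" | "p = t + 2" "i = t \<or> j = t"
      | "p = t + 2" "i = t + 1" "j = t + 1"
      using ij it \<open>t < p\<close> by linarith
    then have "sum g \<A> * sum h \<B> \<le> W.star_weight t * W'.star_weight t \<and>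
        (real t < lam \<longrightarrow> sum g \<A> * sum h \<B> < W.star_weight t * W'.star_weight t)"
    proof cases
      case 1
      note c = common[unfolded 1(1)] and cd = pA[unfolded 1(1)] 1(2)[unfolded i_def 1(1)]
      have "sum g \<A> * sum h \<B> \<le> W.star_weight t * W'.star_weight t"
        by (rule product_bound_Suc(1)[OF W W' pos st(1) t(2) base c AB(1) cd ne(2)])
      moreover have "sum g \<A> * sum h \<B> < W.star_weight t * W'.star_weight t" if "real t < lam"
        by (rule product_bound_Suc(2)[OF W W' pos st(1) t(2) base c AB(1) cd ne(2) that])
      ultimately show ?thesis by blast
    next
      case 2
      note c = common'[unfolded 2(1)] and cd = pB[unfolded 2(1)] 2(2)[unfolded j_def 2(1)]
      have "sum h \<B> * sum g \<A> \<le> W'.star_weight t * W.star_weight t"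
        by (rule product_bound_Suc(1)[OF W' W pos(2,1) st(2) t(2) base(2,1) c AB(2) cd ne(1)])
      moreover have "sum h \<B> * sum g \<A> < W'.star_weight t * W.star_weight t" if "real t < lam"
        by (rule product_bound_Suc(2)[OF W' W pos(2,1) st(2) t(2) base(2,1) c AB(2) cd ne(1) that])
      ultimately show ?thesis by (simp add: mult.commute)
    next
      case 3
      then have "(2 + real t) * (lam - 1) \<le> real t * lam" using levi levj by auto
      then have "2 * lam \<le> real t + 2" by (simp add: algebra_simps)
      then show ?thesis using lam t by simp
    next
      case 4
      note c = common[unfolded 4(1)] and ca = pA[unfolded 4(1)] 4(2)[unfolded i_def 4(1)]
        and cb = pB[unfolded 4(1)] 4(3)[unfolded j_def 4(1)] and cc = ct[unfolded 4(1)]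
      have l: "8/3 < lam" using lam t by simp
      have "sum g \<A> * sum h \<B> \<le> W.star_weight t * W'.star_weight t"
        by (rule product_bound_Suc_Suc(1)[OF W W' pos st t(2) l base c AB(1) ca AB(2) cb cc])
      moreover have "sum g \<A> * sum h \<B> < W.star_weight t * W'.star_weight t" if "real t < lam"
        by (rule product_bound_Suc_Suc(2)[OF W W' pos st t(2) l base c AB(1) ca AB(2) cb cc that])
      ultimately show ?thesis by blast
    qed
    then show ?thesis using ge by linarith
  qed
qed

lemma (in shift_weight) shift_support:
  assumes "1 \<le> i" "i < j" "A \<in> {A. 0 < g A}" shows "shift i j A \<in> {A. 0 < g A}"
  using shift_le[OF assms(1,2), of A] assms(3) by simp

lemma optimal_pair_compress:
  assumes W: "shift_weight m lam g" and W': "shift_weight n lam h" and opt: "optimal_pair t g h \<A> \<B>"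
    and ij: "1 \<le> i" "i < j"
  shows "optimal_pair t g h (compress i j \<A>) (compress i j \<B>)"
    and "sum g \<A> * sum h \<B> \<le> sum g (compress i j \<A>) * sum h (compress i j \<B>)"
proof -
  interpret W: shift_weight m lam g by fact
  interpret W': shift_weight n lam h by fact
  have pos: "\<A> \<subseteq> {A. 0 < g A}" "\<B> \<subseteq> {B. 0 < h B}" and cross: "cross_intersecting t \<A> \<B>"
    using opt by (auto simp: optimal_pair_def)
  show le: "sum g \<A> * sum h \<B> \<le> sum g (compress i j \<A>) * sum h (compress i j \<B>)"
    using ij by (intro mult_mono sum_compress_ge W.shift_le W'.shift_le) (auto simp: sum_nonneg W.nonneg W'.nonneg)
  have fin: "finite A" if "A \<in> \<A>" for A
    using that pos W.finite_in_support by blast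
  have fin': "finite B" if "B \<in> \<B>" for B
    using that pos W'.finite_in_support by blast
  have "cross_intersecting t (compress i j \<A>) (compress i j \<B>)"
    by (rule cross_intersecting_compress[OF cross fin fin'])
  moreover have "compress i j \<A> \<subseteq> {A. 0 < g A}"
    by (rule compress_subset[OF pos(1)]) (rule W.shift_support[OF ij])
  moreover have "compress i j \<B> \<subseteq> {B. 0 < h B}"
    by (rule compress_subset[OF pos(2)]) (rule W'.shift_support[OF ij])
  moreover have "\<forall>\<A>' \<B>'. \<A>' \<subseteq> {A. 0 < g A} \<and> \<B>' \<subseteq> {B. 0 < h B} \<and> cross_intersecting t \<A>' \<B>' \<longrightarrow>
        sum g \<A>' * sum h \<B>' \<le> sum g (compress i j \<A>) * sum h (compress i j \<B>)"
    using opt le unfolding optimal_pair_def by (meson order_trans)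
  ultimately show "optimal_pair t g h (compress i j \<A>) (compress i j \<B>)"
    unfolding optimal_pair_def by blast
qed

text \<open>Compression preserves optimality, as neither weight decreases. In the reversal the kernel \<open>T\<close> itself
  can be taken as the common neighbour, because sets of positive weight form a down-closed family.\<close>

lemma optimal_pair_star:
  assumes W: "shift_weight m lam g" and W': "shift_weight n lam h"
    and t: "1 \<le> t" "real t \<le> lam" and lam: "2 * real t < 3 * (lam - 2)"
    and base: "0 < g {1..t}" "0 < h {1..t}"
  shows "optimal_pair t g h \<A> \<B> \<Longrightarrow>
    sum g \<A> * sum h \<B> \<le> shift_weight.star_weight g t * shift_weight.star_weight h t \<and>
    (real t < lam \<longrightarrow>
      (\<exists>T. finite T \<and> card T = t \<and> \<A> = containing {A. 0 < g A} T \<and> \<B> = containing {B. 0 < h B} T))"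
proof (induction "total_rank id \<A> + total_rank id \<B>" arbitrary: \<A> \<B> rule: less_induct)
  case less
  interpret W: shift_weight m lam g by fact
  interpret W': shift_weight n lam h by fact
  note opt = less.prems
  have pos: "\<A> \<subseteq> {A. 0 < g A}" "\<B> \<subseteq> {B. 0 < h B}" and cross: "cross_intersecting t \<A> \<B>"
    using opt by (auto simp: optimal_pair_def)
  show ?case
  proof (cases "stable \<A> \<and> stable \<B>")
    case True
    then have st: "stable \<A>" "stable \<B>" by auto
    have "finite {1..t}" "card {1..t} = t" by auto
    then show ?thesis using stable_optimal_pair[OF W W' opt st t lam base] by blast
  next
    case False
    then obtain i j where ij: "1 \<le> i" "i < j"
      and un: "(\<exists>A\<in>\<A>. shift i j A \<notin> \<A>) \<or> (\<exists>B\<in>\<B>. shift i j B \<notin> \<B>)"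
      unfolding stable_def by blast
    have finA: "finite \<A>" "finite \<B>"
      using pos W.finite_support W'.finite_support finite_subset by blast+
    have fin: "finite A" if "A \<in> \<A>" for A
      using that pos W.finite_in_support by blast
    have fin': "finite B" if "B \<in> \<B>" for B
      using that pos W'.finite_in_support by blast
    have idij: "id i < id j" using ij by simp
    have le: "total_rank id (compress i j \<A>) \<le> total_rank id \<A>"
      by (rule total_rank_compress(1)[where f = id, OF finA(1) _ idij]) (rule fin)
    have le': "total_rank id (compress i j \<B>) \<le> total_rank id \<B>"
      by (rule total_rank_compress(1)[where f = id, OF finA(2) _ idij]) (rule fin')
    have "total_rank id (compress i j \<A>) + total_rank id (compress i j \<B>) < total_rank id \<A> + total_rank id \<B>"
      using un
    proof
      assume "\<exists>A\<in>\<A>. shift i j A \<notin> \<A>"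
      then obtain A where A: "A \<in> \<A>" "shift i j A \<notin> \<A>" by blast
      have "total_rank id (compress i j \<A>) < total_rank id \<A>"
        by (rule total_rank_compress(2)[where f = id, OF finA(1) _ idij A]) (rule fin)
      then show ?thesis using le' by simp
    next
      assume "\<exists>B\<in>\<B>. shift i j B \<notin> \<B>"
      then obtain B where B: "B \<in> \<B>" "shift i j B \<notin> \<B>" by blast
      have "total_rank id (compress i j \<B>) < total_rank id \<B>"
        by (rule total_rank_compress(2)[where f = id, OF finA(2) _ idij B]) (rule fin')
      then show ?thesis using le by simp
    qed
    note IH = less.hyps[OF this optimal_pair_compress(1)[OF W W' opt ij]]
    have "sum g \<A> * sum h \<B> \<le> W.star_weight t * W'.star_weight t"
      using IH optimal_pair_compress(2)[OF W W' opt ij] by linarith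
    moreover have "\<exists>T. finite T \<and> card T = t \<and> \<A> = containing {A. 0 < g A} T \<and> \<B> = containing {B. 0 < h B} T"
      if tl: "real t < lam"
    proof -
      obtain T where T: "finite T" "card T = t" "compress i j \<A> = containing {A. 0 < g A} T"
        "compress i j \<B> = containing {B. 0 < h B} T" using IH tl by blast
      have "0 < W.star_weight t * W'.star_weight t"
        using base W.star_weight_pos W'.star_weight_pos by simp
      also have "\<dots> \<le> sum g \<A> * sum h \<B>"
        using optimal_pair_ge_star[OF W opt] by (simp add: W'.star_weight_def)
      finally have "\<A> \<noteq> {}" "\<B> \<noteq> {}" by auto
      then have "containing {A. 0 < g A} T \<noteq> {}" "containing {B. 0 < h B} T \<noteq> {}"
        unfolding T(3,4)[symmetric] compress_def by simp_all
      then have "0 < g T" "0 < h T"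
        using W.support_subset W'.support_subset unfolding containing_def by blast+
      then have TT: "T \<in> containing {A. 0 < g A} T" "T \<in> containing {B. 0 < h B} T"
        by (simp_all add: containing_def)
      have "\<exists>T'. finite T' \<and> card T' = card T \<and> \<A> = containing {A. 0 < g A} T' \<and> \<B> = containing {B. 0 < h B} T'"
      proof (rule containing_uncompress[OF T(3) pos(1) W.finite_support _ T(4) pos(2) W'.finite_support])
        show "cross_intersecting (card T) \<A> \<B>" using cross T by simp
        show "finite T" by fact
        show "\<exists>F\<in>containing {B. 0 < h B} T. E \<inter> F = T \<and> E' \<inter> F = T \<and> (i \<in> T \<longrightarrow> j \<notin> F)"
          if "j \<notin> T" "E \<in> containing {A. 0 < g A} T" "E' \<in> containing {A. 0 < g A} T" for E E'
          using TT(2) that by (intro bexI[of _ T]) (auto simp: containing_def)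
        show "\<exists>E\<in>containing {A. 0 < g A} T. F \<inter> E = T \<and> F' \<inter> E = T \<and> (i \<in> T \<longrightarrow> j \<notin> E)"
          if "j \<notin> T" "F \<in> containing {B. 0 < h B} T" "F' \<in> containing {B. 0 < h B} T" for F F'
          using TT(1) that by (intro bexI[of _ T]) (auto simp: containing_def)
      qed (use W.shift_support[OF ij] W'.shift_support[OF ij] in blast)+
      then show ?thesis using T(2) by blast
    qed
    ultimately show ?thesis by blast
  qed
qed

text \<open>There are only finitely many families of sets of positive weight, so an optimal pair exists and dominates
  every other pair.\<close>

theorem weighted_cross_intersecting:
  assumes W: "shift_weight m lam g" and W': "shift_weight n lam h"
    and t: "1 \<le> t" "real t \<le> lam" and lam: "2 * real t < 3 * (lam - 2)"
    and base: "0 < g {1..t}" "0 < h {1..t}"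
    and pos: "\<A> \<subseteq> {A. 0 < g A}" "\<B> \<subseteq> {B. 0 < h B}" and cross: "cross_intersecting t \<A> \<B>"
  shows "sum g \<A> * sum h \<B> \<le> shift_weight.star_weight g t * shift_weight.star_weight h t"
    and "real t < lam \<Longrightarrow> sum g \<A> * sum h \<B> = shift_weight.star_weight g t * shift_weight.star_weight h t \<Longrightarrow>
      \<exists>T. finite T \<and> card T = t \<and> \<A> = containing {A. 0 < g A} T \<and> \<B> = containing {B. 0 < h B} T"
proof -
  interpret W: shift_weight m lam g by fact
  interpret W': shift_weight n lam h by fact
  let ?P = "{(\<A>, \<B>). \<A> \<subseteq> {A. 0 < g A} \<and> \<B> \<subseteq> {B. 0 < h B} \<and> cross_intersecting t \<A> \<B>}"
  let ?f = "\<lambda>(\<A>, \<B>). sum g \<A> * sum h \<B>"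
  have "finite ?P"
    by (rule finite_subset[of _ "Pow {A. 0 < g A} \<times> Pow {B. 0 < h B}"])
      (use W.finite_support W'.finite_support in auto)
  moreover have "(\<A>, \<B>) \<in> ?P" using pos cross by simp
  ultimately have fin: "finite (?f ` ?P)" "?f ` ?P \<noteq> {}" by blast+
  then have "Max (?f ` ?P) \<in> ?f ` ?P" by (rule Max_in)
  then obtain \<A>' \<B>' where max: "(\<A>', \<B>') \<in> ?P" "Max (?f ` ?P) = sum g \<A>' * sum h \<B>'" by auto
  have ub: "sum g \<C> * sum h \<D> \<le> sum g \<A>' * sum h \<B>'" if "(\<C>, \<D>) \<in> ?P" for \<C> \<D>
    using Max_ge[OF fin(1) imageI[OF that]] by (simp only: prod.case max(2))
  have "optimal_pair t g h \<A>' \<B>'" using max(1) ub unfolding optimal_pair_def by simp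
  from optimal_pair_star[OF W W' t lam base this]
  have le: "sum g \<A>' * sum h \<B>' \<le> W.star_weight t * W'.star_weight t" by blast
  then show "sum g \<A> * sum h \<B> \<le> W.star_weight t * W'.star_weight t"
    using ub[of \<A> \<B>] pos cross by simp
  assume tl: "real t < lam" and eq: "sum g \<A> * sum h \<B> = W.star_weight t * W'.star_weight t"
  have "optimal_pair t g h \<A> \<B>"
    unfolding optimal_pair_def
  proof (intro conjI pos cross allI impI)
    fix \<C> \<D> assume "\<C> \<subseteq> {A. 0 < g A} \<and> \<D> \<subseteq> {B. 0 < h B} \<and> cross_intersecting t \<C> \<D>"
    then have "sum g \<C> * sum h \<D> \<le> sum g \<A>' * sum h \<B>'" using ub[of \<C> \<D>] by simp
    then show "sum g \<C> * sum h \<D> \<le> sum g \<A> * sum h \<B>" using le eq by linarith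
  qed
  from optimal_pair_star[OF W W' t lam base this] tl
  show "\<exists>T. finite T \<and> card T = t \<and> \<A> = containing {A. 0 < g A} T \<and> \<B> = containing {B. 0 < h B} T" by blast
qed

section \<open>Signed sets and their ones\<close>

lemma in_graph_iff: "(x, k) \<in> (\<lambda>x. (x, y x)) ` X \<longleftrightarrow> x \<in> X \<and> k = y x"
  by auto

lemma signed_sets_iff:
  "A \<in> signed_sets n c r \<longleftrightarrow>
     finite A \<and> card A = r \<and> inj_on fst A \<and> (\<forall>(x, y)\<in>A. x \<in> {1..n} \<and> y \<in> {1..c x})"
proof
  assume "A \<in> signed_sets n c r"
  then obtain X y where A: "A = (\<lambda>x. (x, y x)) ` X" "X \<in> nsets {1..n} r" "\<forall>x\<in>X. y x \<in> {1..c x}"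
    unfolding signed_sets_def by blast
  have "inj_on (\<lambda>x. (x, y x)) X" by (simp add: inj_on_def)
  then have "card A = r" using A by (simp add: card_image nsets_def)
  moreover have "finite A" "inj_on fst A" using A by (auto simp: nsets_def inj_on_def)
  moreover have "\<forall>(x, y)\<in>A. x \<in> {1..n} \<and> y \<in> {1..c x}" using A by (auto simp: nsets_def)
  ultimately show "finite A \<and> card A = r \<and> inj_on fst A \<and> (\<forall>(x, y)\<in>A. x \<in> {1..n} \<and> y \<in> {1..c x})"
    by blast
next
  assume A: "finite A \<and> card A = r \<and> inj_on fst A \<and> (\<forall>(x, y)\<in>A. x \<in> {1..n} \<and> y \<in> {1..c x})"
  define y where "y x = snd (inv_into A fst x)" for x
  have y: "y (fst z) = snd z" if "z \<in> A" for z using A that by (simp add: y_def)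
  have "(\<lambda>x. (x, y x)) ` (fst ` A) = (\<lambda>z. (fst z, y (fst z))) ` A" by (simp add: image_image)
  also have "\<dots> = id ` A" by (rule image_cong) (simp_all add: y)
  finally have "A = (\<lambda>x. (x, y x)) ` (fst ` A)" by simp
  moreover have "fst ` A \<in> nsets {1..n} r" using A by (auto simp: nsets_def card_image)
  moreover have "\<forall>x\<in>fst ` A. y x \<in> {1..c x}" using A y by force
  ultimately show "A \<in> signed_sets n c r" unfolding signed_sets_def by blast
qed

lemma signed_setsD:
  assumes "A \<in> signed_sets n c r"
  shows "finite A" "card A = r" "inj_on fst A"
    and "(x, y) \<in> A \<Longrightarrow> 1 \<le> x \<and> x \<le> n" "(x, y) \<in> A \<Longrightarrow> 1 \<le> y \<and> y \<le> c x"
    and "(x, y) \<in> A \<Longrightarrow> (x, z) \<in> A \<Longrightarrow> y = z"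
proof -
  have A: "finite A \<and> card A = r \<and> inj_on fst A \<and> (\<forall>(x, y)\<in>A. x \<in> {1..n} \<and> y \<in> {1..c x})"
    using assms signed_sets_iff by blast
  then show "finite A" "card A = r" and i: "inj_on fst A" by auto
  show "1 \<le> x \<and> x \<le> n" "1 \<le> y \<and> y \<le> c x" if "(x, y) \<in> A" using A that by auto
  show "y = z" if "(x, y) \<in> A" "(x, z) \<in> A" using inj_onD[OF i _ that] by simp
qed

lemma finite_signed_sets: "finite (signed_sets n c r)"
proof (rule finite_subset)
  show "signed_sets n c r \<subseteq> Pow (SIGMA x:{1..n}. {1..c x})" using signed_setsD(4,5) by fastforce
qed simp

lemma signed_sets_subset:
  assumes "A \<in> signed_sets n c r" "T \<subseteq> A" shows "T \<in> signed_sets n c (card T)"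
proof -
  have A: "finite A" "inj_on fst A" "\<forall>(x, y)\<in>A. x \<in> {1..n} \<and> y \<in> {1..c x}"
    using assms(1) unfolding signed_sets_iff by blast+
  have "finite T" using assms(2) A(1) by (rule finite_subset)
  moreover have "inj_on fst T" using A(2) assms(2) by (rule inj_on_subset)
  ultimately show ?thesis using A(3) assms(2) unfolding signed_sets_iff by blast
qed

lemma signed_replace:
  assumes A: "A \<in> signed_sets n c r" and ab: "(a, b) \<in> A" and y: "1 \<le> y" "y \<le> c a" "y \<noteq> b"
  shows "insert (a, y) (A - {(a, b)}) \<in> signed_sets n c r"
    and "(a, y) \<notin> A"
proof -
  note D = signed_setsD[OF A]
  show n: "(a, y) \<notin> A" using D(6)[OF ab] y by blast
  have "card (insert (a, y) (A - {(a, b)})) = Suc (card (A - {(a, b)}))" using n D(1) by simp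
  also have "\<dots> = card A" using ab D(1) by (rule card_Suc_Diff1[rotated])
  finally have "card (insert (a, y) (A - {(a, b)})) = r" using D(2) by simp
  moreover have "inj_on fst (insert (a, y) (A - {(a, b)}))"
  proof (rule inj_onI)
    fix u v assume uv: "u \<in> insert (a, y) (A - {(a, b)})" "v \<in> insert (a, y) (A - {(a, b)})" "fst u = fst v"
    have "fst z \<noteq> a" if "z \<in> A - {(a, b)}" for z
      using that D(6)[OF ab] by (cases z) auto
    then consider "u = (a, y)" "v = (a, y)" | "u \<in> A" "v \<in> A"
      using uv by (metis fst_conv insertE DiffD1)
    then show "u = v"
    proof cases
      case 2
      then show ?thesis using inj_onD[OF D(3) uv(3)] by blast
    qed simp
  qed
  moreover have "x \<in> {1..n} \<and> z \<in> {1..c x}" if "(x, z) \<in> insert (a, y) (A - {(a, b)})" for x z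
  proof (cases "(x, z) \<in> A")
    case True
    then show ?thesis using D(4)[OF True] D(5)[OF True] by simp
  next
    case False
    then have "x = a" "z = y" using that by auto
    then show ?thesis using D(4)[OF ab] y by simp
  qed
  then have "\<forall>(x, z)\<in>insert (a, y) (A - {(a, b)}). x \<in> {1..n} \<and> z \<in> {1..c x}" by blast
  ultimately show "insert (a, y) (A - {(a, b)}) \<in> signed_sets n c r"
    using D(1) unfolding signed_sets_iff by (intro conjI) simp_all
qed

lemma signed_shift:
  assumes "A \<in> signed_sets n c r" "2 \<le> b"
  shows "shift (a, 1) (a, b) A \<in> signed_sets n c r"
proof (cases "(a, b) \<in> A \<and> (a, 1) \<notin> A")
  case True
  then have "b \<le> c a" using signed_setsD(5)[OF assms(1)] by blast
  then have "insert (a, 1) (A - {(a, b)}) \<in> signed_sets n c r"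
    by (intro signed_replace(1)[OF assms(1)]) (use True assms in auto)
  then show ?thesis using True by (simp add: shift_def)
next
  case False
  then show ?thesis using assms unfolding shift_def by auto
qed

definition ones :: "(nat \<times> nat) set \<Rightarrow> nat set" where
  "ones A = {x. (x, 1) \<in> A}"

text \<open>The weight to which the weighted theorem is applied. It is positive exactly for the sets that occur as a
  set of ones.\<close>

definition ones_count :: "nat \<Rightarrow> (nat \<Rightarrow> nat) \<Rightarrow> nat \<Rightarrow> nat set \<Rightarrow> real" where
  "ones_count n c r X = real (card {A \<in> signed_sets n c r. ones A = X})"

lemma finite_signed_sets_Collect: "finite {A \<in> signed_sets n c r. P A}"
  using finite_signed_sets by simp

lemma ones_count_pos_iff: "0 < ones_count n c r X \<longleftrightarrow> (\<exists>A\<in>signed_sets n c r. ones A = X)"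
  unfolding ones_count_def using finite_signed_sets_Collect[of n c r "\<lambda>A. ones A = X"] by (auto simp: card_gt_0_iff)

lemma IP_sequence_ge:
  assumes "IP_sequence n c" "1 \<le> x" "x \<le> n" shows "c 1 \<le> c x"
  using assms unfolding IP_sequence_def mono_on_def by auto

text \<open>Exchanging the coordinates \<open>i\<close> and \<open>j\<close> maps signed sets to signed sets: the letter at
  \<open>i\<close> is admissible at \<open>j\<close> since \<open>c\<close> is nondecreasing, and the letter moved to
  \<open>i\<close> is a \<open>1\<close>.\<close>

lemma ones_count_shift:
  assumes c: "IP_sequence n c" and ij: "1 \<le> i" "i < j"
  shows "ones_count n c r X \<le> ones_count n c r (shift i j X)"
proof (cases "j \<in> X \<and> i \<notin> X")
  case False
  then have "shift i j X = X" by (auto simp: shift_def)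
  then show ?thesis by simp
next
  case True
  define \<tau> where "\<tau> x = (if x = i then j else if x = j then i else x)" for x
  define \<phi> :: "nat \<times> nat \<Rightarrow> nat \<times> nat" where "\<phi> z = (\<tau> (fst z), snd z)" for z
  have \<tau>\<tau>: "\<tau> (\<tau> x) = x" for x by (simp add: \<tau>_def)
  have inj: "inj \<tau>" by (metis \<tau>\<tau> injI)
  have inj\<phi>: "inj \<phi>" using inj by (auto simp: inj_def \<phi>_def prod_eq_iff)
  have "card {A \<in> signed_sets n c r. ones A = X} \<le> card {A \<in> signed_sets n c r. ones A = shift i j X}"
  proof (rule card_inj_on_le[where f = "(`) \<phi>"])
    show "inj_on ((`) \<phi>) {A \<in> signed_sets n c r. ones A = X}"
      using inj_image_eq_iff[OF inj\<phi>] by (auto simp: inj_on_def)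
    show "finite {A \<in> signed_sets n c r. ones A = shift i j X}" by (rule finite_signed_sets_Collect)
    show "(`) \<phi> ` {A \<in> signed_sets n c r. ones A = X} \<subseteq> {A \<in> signed_sets n c r. ones A = shift i j X}"
    proof (rule image_subsetI)
      fix A assume "A \<in> {A \<in> signed_sets n c r. ones A = X}"
      then have A: "A \<in> signed_sets n c r" and X: "ones A = X" by auto
      note D = signed_setsD[OF A]
      have jA: "(j, 1) \<in> A" and iA: "(i, 1) \<notin> A" using X True by (auto simp: ones_def)
      have jn: "j \<le> n" using D(4)[OF jA] by simp
      have "card (\<phi> ` A) = r" using D(2) inj\<phi> by (simp add: card_image inj_on_subset)
      moreover have "inj_on fst (\<phi> ` A)"
      proof (rule inj_onI)
        fix u v assume "u \<in> \<phi> ` A" "v \<in> \<phi> ` A" and e: "fst u = fst v"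
        then obtain u' v' where uv: "u' \<in> A" "v' \<in> A" "u = \<phi> u'" "v = \<phi> v'" by auto
        then have "fst u' = fst v'" using e inj by (simp add: \<phi>_def inj_eq)
        then show "u = v" using uv inj_onD[OF D(3)] by blast
      qed
      moreover have "\<forall>(x, y)\<in>\<phi> ` A. x \<in> {1..n} \<and> y \<in> {1..c x}"
      proof -
        have "fst (\<phi> z) \<in> {1..n} \<and> snd (\<phi> z) \<in> {1..c (fst (\<phi> z))}" if z: "z \<in> A" for z
        proof -
          obtain x y where z': "z = (x, y)" by fastforce
          have xy: "1 \<le> x" "x \<le> n" "1 \<le> y" "y \<le> c x" using D(4,5) z z' by auto
          consider "x = i" | "x = j" | "x \<noteq> i" "x \<noteq> j" by blast
          then show ?thesis
          proof cases
            case 1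
            have "c i \<le> c j" using c ij jn unfolding IP_sequence_def mono_on_def by auto
            then show ?thesis using 1 xy z' ij jn by (simp add: \<phi>_def \<tau>_def)
          next
            case 2
            then have "y = 1" using D(6)[OF jA] z z' by auto
            moreover have "0 < c i" using c ij jn unfolding IP_sequence_def by auto
            ultimately show ?thesis using 2 xy z' ij jn by (simp add: \<phi>_def \<tau>_def)
          next
            case 3
            then show ?thesis using xy z' by (simp add: \<phi>_def \<tau>_def)
          qed
        qed
        then have "\<forall>w\<in>\<phi> ` A. fst w \<in> {1..n} \<and> snd w \<in> {1..c (fst w)}" by blast
        then show ?thesis by (simp only: case_prod_unfold)
      qed
      moreover have "finite (\<phi> ` A)" using D(1) by simp
      ultimately have S: "\<phi> ` A \<in> signed_sets n c r" unfolding signed_sets_iff by (intro conjI)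
      have "ones (\<phi> ` A) = \<tau> ` ones A"
      proof (rule set_eqI)
        fix x
        have "x \<in> ones (\<phi> ` A) \<longleftrightarrow> (\<exists>w. (w, 1) \<in> A \<and> x = \<tau> w)" by (force simp: ones_def \<phi>_def)
        then show "x \<in> ones (\<phi> ` A) \<longleftrightarrow> x \<in> \<tau> ` ones A" by (auto simp: ones_def)
      qed
      also have "\<dots> = insert i (X - {j})"
        unfolding X using True ij by (auto simp: \<tau>_def image_iff)
      also have "\<dots> = shift i j X" using True by (simp add: shift_def)
      finally show "\<phi> ` A \<in> {A \<in> signed_sets n c r. ones A = shift i j X}" using S by blast
    qed
  qed
  then show ?thesis by (simp add: ones_count_def)
qed

text \<open>Overwrite the one at \<open>x\<close> by any of the at least \<open>lam\<close> other letters.\<close>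

lemma ones_count_drop:
  assumes c: "IP_sequence n c" "lam + 1 \<le> real (c 1)" and x: "x \<in> X"
  shows "lam * ones_count n c r X \<le> ones_count n c r (X - {x})"
proof (cases "\<exists>A\<in>signed_sets n c r. ones A = X")
  case False
  then have "ones_count n c r X = 0" using ones_count_pos_iff[of n c r X] by (simp add: ones_count_def)
  then show ?thesis by (simp add: ones_count_def)
next
  case True
  then obtain A0 where "A0 \<in> signed_sets n c r" "(x, 1) \<in> A0" using x by (auto simp: ones_def)
  then have "1 \<le> x" "x \<le> n" using signed_setsD(4) by blast+
  then have "c 1 \<le> c x" by (rule IP_sequence_ge[OF c(1)])
  then have lx: "lam \<le> real (card {2..c x})" using c(2) by simp
  let ?S = "{A \<in> signed_sets n c r. ones A = X}" and ?S' = "{A \<in> signed_sets n c r. ones A = X - {x}}"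
  let ?f = "\<lambda>(A, y). insert (x, y) (A - {(x, 1)})"
  have x1: "(x, 1) \<in> A" if "A \<in> ?S" for A using that x by (auto simp: ones_def)
  have "card (?S \<times> {2..c x}) \<le> card ?S'"
  proof (rule card_inj_on_le[where f = ?f])
    show "inj_on ?f (?S \<times> {2..c x})"
    proof (rule inj_onI)
      fix u v assume u: "u \<in> ?S \<times> {2..c x}" and v: "v \<in> ?S \<times> {2..c x}" and e: "?f u = ?f v"
      obtain A y B z where uv: "u = (A, y)" "v = (B, z)" by fastforce
      have A: "A \<in> ?S" "B \<in> ?S" "2 \<le> y" "2 \<le> z" "y \<le> c x" "z \<le> c x" using u v uv by auto
      have nA: "(x, k) \<notin> A - {(x, 1)}" "(x, k) \<notin> B - {(x, 1)}" for k
        using x1[OF A(1)] x1[OF A(2)] signed_setsD(6)[of A n c r x 1 k] signed_setsD(6)[of B n c r x 1 k] A by auto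
      have e': "insert (x, y) (A - {(x, 1)}) = insert (x, z) (B - {(x, 1)})" using e uv by simp
      then have "(x, y) \<in> insert (x, z) (B - {(x, 1)})" by blast
      then have "y = z" using nA by blast
      then have "A - {(x, 1)} = B - {(x, 1)}" using e' nA by (metis insert_ident)
      then have "A = B" using x1[OF A(1)] x1[OF A(2)] by (metis insert_Diff)
      then show "u = v" using uv \<open>y = z\<close> by simp
    qed
    show "?f ` (?S \<times> {2..c x}) \<subseteq> ?S'"
    proof (rule image_subsetI)
      fix u assume u: "u \<in> ?S \<times> {2..c x}"
      obtain A y where uy: "u = (A, y)" by fastforce
      have A: "A \<in> signed_sets n c r" "ones A = X" "2 \<le> y" "y \<le> c x" "(x, 1) \<in> A" using u uy x1 by auto
      have "insert (x, y) (A - {(x, 1)}) \<in> signed_sets n c r"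
        by (rule signed_replace(1)[OF A(1,5)]) (use A in auto)
      moreover have "ones (insert (x, y) (A - {(x, 1)})) = X - {x}" using A(2,3) by (auto simp: ones_def)
      ultimately show "?f u \<in> ?S'" using uy by simp
    qed
  qed (rule finite_signed_sets_Collect)
  then have "real (card (?S \<times> {2..c x})) \<le> real (card ?S')" by (simp only: of_nat_le_iff)
  then have "real (card {2..c x}) * ones_count n c r X \<le> ones_count n c r (X - {x})"
    unfolding ones_count_def card_cartesian_product of_nat_mult by (simp only: mult.commute)
  moreover have "lam * ones_count n c r X \<le> real (card {2..c x}) * ones_count n c r X"
    using lx by (intro mult_right_mono) (simp_all add: ones_count_def)
  ultimately show ?thesis by linarith
qed

lemma shift_weight_ones_count:
  assumes "IP_sequence n c" "lam + 1 \<le> real (c 1)" "2 < lam"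
  shows "shift_weight n lam (ones_count n c r)"
proof
  show "A \<subseteq> {1..n}" if p: "0 < ones_count n c r A" for A
  proof -
    obtain B where B: "B \<in> signed_sets n c r" "ones B = A" using iffD1[OF ones_count_pos_iff p] by blast
    show ?thesis
    proof
      fix x assume "x \<in> A"
      then have "(x, 1) \<in> B" using B(2) unfolding ones_def by blast
      then show "x \<in> {1..n}" using signed_setsD(4)[OF B(1)] by simp
    qed
  qed
  show "0 \<le> ones_count n c r A" for A by (simp add: ones_count_def)
  show "ones_count n c r A \<le> ones_count n c r (shift i j A)" if "1 \<le> i" "i < j" for i j A
    by (rule ones_count_shift[OF assms(1) that])
  show "lam * ones_count n c r A \<le> ones_count n c r (A - {x})" if "x \<in> A" for x A
    by (rule ones_count_drop[OF assms(1,2) that])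
qed fact

lemma ones_count_base_pos:
  assumes c: "IP_sequence n c" "2 \<le> c 1" and "t \<le> r" "r \<le> n"
  shows "0 < ones_count n c r {1..t}"
proof -
  let ?y = "\<lambda>x. if x \<le> t then 1 else 2 :: nat"
  let ?A = "(\<lambda>x. (x, ?y x)) ` {1..r}"
  have "{1..r} \<in> nsets {1..n} r" using assms by (auto simp: nsets_def)
  moreover have "\<forall>x\<in>{1..r}. ?y x \<in> {1..c x}"
  proof
    fix x assume "x \<in> {1..r}"
    then have "2 \<le> c x" using IP_sequence_ge[OF c(1), of x] assms by auto
    then show "?y x \<in> {1..c x}" by auto
  qed
  ultimately have "?A \<in> signed_sets n c r"
    unfolding signed_sets_def
    by (intro CollectI exI[of _ "{1..r}"] exI[of _ ?y] conjI refl)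
  moreover have "ones ?A = {1..t}"
  proof (rule set_eqI)
    fix x
    have "x \<in> ones ?A \<longleftrightarrow> x \<in> {1..r} \<and> 1 = ?y x"
      unfolding ones_def mem_Collect_eq by (rule in_graph_iff)
    also have "\<dots> \<longleftrightarrow> x \<in> {1..t}" using assms(3) by simp
    finally show "x \<in> ones ?A \<longleftrightarrow> x \<in> {1..t}" .
  qed
  ultimately show ?thesis using iffD2[OF ones_count_pos_iff] by blast
qed

lemma sum_ones_count:
  assumes "finite \<X>"
  shows "sum (ones_count n c r) \<X> = real (card {A \<in> signed_sets n c r. ones A \<in> \<X>})"
proof -
  have "card (\<Union>X\<in>\<X>. {A \<in> signed_sets n c r. ones A = X}) = (\<Sum>X\<in>\<X>. card {A \<in> signed_sets n c r. ones A = X})"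
    by (rule card_UN_disjoint) (use assms finite_signed_sets_Collect in auto)
  moreover have "(\<Union>X\<in>\<X>. {A \<in> signed_sets n c r. ones A = X}) = {A \<in> signed_sets n c r. ones A \<in> \<X>}" by auto
  ultimately show ?thesis by (simp add: ones_count_def)
qed

lemma ones_in_containing_iff:
  assumes "A \<in> signed_sets n c r"
  shows "ones A \<in> containing {X. 0 < ones_count n c r X} T \<longleftrightarrow> (\<lambda>x. (x, 1)) ` T \<subseteq> A"
proof -
  have "0 < ones_count n c r (ones A)" using assms iffD2[OF ones_count_pos_iff] by blast
  then show ?thesis by (auto simp: containing_def ones_def)
qed

lemma star_weight_ones_count:
  assumes "shift_weight n lam (ones_count n c r)"
  shows "shift_weight.star_weight (ones_count n c r) t = real (card (signed_sets_fixed n c r t))"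
proof -
  interpret shift_weight n lam "ones_count n c r" by fact
  have "finite (containing {X. 0 < ones_count n c r X} {1..t})"
    using finite_support by (simp add: containing_def)
  then have "star_weight t = real (card {A \<in> signed_sets n c r. ones A \<in> containing {X. 0 < ones_count n c r X} {1..t}})"
    unfolding star_weight_def by (rule sum_ones_count)
  also have "{A \<in> signed_sets n c r. ones A \<in> containing {X. 0 < ones_count n c r X} {1..t}} = signed_sets_fixed n c r t"
    unfolding signed_sets_fixed_def
    by (rule Collect_cong, rule conj_cong[OF refl], subst ones_in_containing_iff) auto
  finally show ?thesis .
qed

lemma card_signed_sets_fixed_pos:
  assumes "IP_sequence n c" "2 \<le> c 1" "t \<le> r" "r \<le> n"
  shows "0 < card (signed_sets_fixed n c r t)"
proof -
  obtain A where A: "A \<in> signed_sets n c r" "ones A = {1..t}"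
    using iffD1[OF ones_count_pos_iff ones_count_base_pos[OF assms]] by blast
  then have "A \<in> signed_sets_fixed n c r t" unfolding signed_sets_fixed_def ones_def by blast
  moreover have "finite (signed_sets_fixed n c r t)" unfolding signed_sets_fixed_def by (rule finite_signed_sets_Collect)
  ultimately show ?thesis by (auto simp: card_gt_0_iff)
qed

text \<open>Compression of any letter to \<open>1\<close> leaves such a family unchanged.\<close>

definition normalised :: "(nat \<times> nat) set set \<Rightarrow> bool" where
  "normalised \<A> \<longleftrightarrow> (\<forall>A\<in>\<A>. \<forall>a b. 2 \<le> b \<longrightarrow> shift (a, 1) (a, b) A \<in> \<A>)"

text \<open>If the two sets share \<open>(a, b)\<close> with \<open>b > 1\<close>, replacing this pair by \<open>(a, 1)\<close> in
  \<open>A\<close> stays in the family, destroys this common element and creates none, as \<open>B\<close> carries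
  \<open>b\<close> at \<open>a\<close>. Hence finally only common ones are left.\<close>

lemma normalised_ones_inter:
  assumes norm: "normalised \<A>" and cross: "cross_intersecting t \<A> \<B>"
    and sub: "\<A> \<subseteq> signed_sets m c r" "\<B> \<subseteq> signed_sets n d s" and B: "B \<in> \<B>"
  shows "A \<in> \<A> \<Longrightarrow> t \<le> card (ones A \<inter> ones B)"
proof (induction "card {z \<in> A \<inter> B. snd z \<noteq> 1}" arbitrary: A rule: less_induct)
  case less
  have SA: "A \<in> signed_sets m c r" and SB: "B \<in> signed_sets n d s" using less.prems B sub by auto
  note DA = signed_setsD[OF SA] and DB = signed_setsD[OF SB]
  show ?case
  proof (cases "{z \<in> A \<inter> B. snd z \<noteq> 1} = {}")
    case True
    then have eq: "A \<inter> B = (\<lambda>x. (x, 1)) ` (ones A \<inter> ones B)" by (force simp: ones_def)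
    have "inj_on (\<lambda>x. (x, 1::nat)) (ones A \<inter> ones B)" by (simp add: inj_on_def)
    then have "card (A \<inter> B) = card (ones A \<inter> ones B)" unfolding eq by (rule card_image)
    moreover have "t \<le> card (A \<inter> B)" using cross less.prems B unfolding cross_intersecting_def by blast
    ultimately show ?thesis by linarith
  next
    case False
    then obtain a b where ab: "(a, b) \<in> A" "(a, b) \<in> B" "b \<noteq> 1" by auto
    have b2: "2 \<le> b" using DA(5)[OF ab(1)] ab(3) by simp
    have n1: "(a, 1) \<notin> A" "(a, 1) \<notin> B" using DA(6)[OF ab(1)] DB(6)[OF ab(2)] ab(3) by blast+
    let ?A = "insert (a, 1) (A - {(a, b)})"
    have A': "?A \<in> \<A>" using norm less.prems b2 ab(1) n1(1) unfolding normalised_def shift_def by (metis (no_types))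
    have "{z \<in> ?A \<inter> B. snd z \<noteq> 1} \<subseteq> {z \<in> A \<inter> B. snd z \<noteq> 1}" using n1(2) by blast
    moreover have "(a, b) \<notin> ?A" "(a, b) \<in> {z \<in> A \<inter> B. snd z \<noteq> 1}" using ab by simp_all
    ultimately have "{z \<in> ?A \<inter> B. snd z \<noteq> 1} \<subset> {z \<in> A \<inter> B. snd z \<noteq> 1}" by blast
    then have "card {z \<in> ?A \<inter> B. snd z \<noteq> 1} < card {z \<in> A \<inter> B. snd z \<noteq> 1}"
      using DA(1) by (intro psubset_card_mono) auto
    from less.hyps[OF this A'] have "t \<le> card (ones ?A \<inter> ones B)" .
    moreover have "ones ?A \<inter> ones B = ones A \<inter> ones B"
      using n1(2) ab(3) unfolding ones_def by blast
    ultimately show ?thesis by simp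
  qed
qed

text \<open>Two signed sets forbid at most two letters at each coordinate, so three letters suffice to avoid both.
  This provides the common neighbours that the reversal of a compression requires.\<close>

lemma avoiding_extension:
  assumes F0: "F0 \<in> signed_sets n d s" "T \<subseteq> F0" and d: "\<And>x. 1 \<le> x \<Longrightarrow> x \<le> n \<Longrightarrow> 3 \<le> d x"
    and E: "E \<in> signed_sets m c r" "E' \<in> signed_sets m c r" "T \<subseteq> E" "T \<subseteq> E'"
  shows "\<exists>F\<in>containing (signed_sets n d s) T. E \<inter> F = T \<and> E' \<inter> F = T"
proof -
  note D = signed_setsD[OF F0(1)]
  define X where "X = fst ` F0 - fst ` T"
  have "\<exists>y. 1 \<le> y \<and> y \<le> d x \<and> (x, y) \<notin> E \<and> (x, y) \<notin> E'" if "x \<in> X" for x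
  proof -
    have "1 \<le> x" "x \<le> n" using that D(4) by (force simp: X_def)+
    then have "3 \<le> d x" by (rule d)
    moreover have "\<exists>y. y \<in> {1, 2, 3} \<and> (x, y) \<notin> E \<and> (x, y) \<notin> E'"
    proof (rule ccontr)
      assume "\<not> ?thesis"
      then have *: "(x, 1) \<in> E \<or> (x, 1) \<in> E'" "(x, 2) \<in> E \<or> (x, 2) \<in> E'" "(x, 3) \<in> E \<or> (x, 3) \<in> E'" by auto
      have u: "\<not> ((x, 1) \<in> G \<and> (x, 2) \<in> G)" "\<not> ((x, 1) \<in> G \<and> (x, 3) \<in> G)" "\<not> ((x, 2) \<in> G \<and> (x, 3) \<in> G)"
        if "G \<in> signed_sets m c r" for G
        using signed_setsD(6)[OF that, of x 1 2] signed_setsD(6)[OF that, of x 1 3]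
          signed_setsD(6)[OF that, of x 2 3] by auto
      show False using * u[OF E(1)] u[OF E(2)] by blast
    qed
    then obtain y where "y \<in> {1, 2, 3}" and y: "(x, y) \<notin> E" "(x, y) \<notin> E'" by blast
    then have "1 \<le> y" "y \<le> 3" by auto
    ultimately show ?thesis using y by (intro exI[of _ y]) simp
  qed
  then obtain y where y: "\<And>x. x \<in> X \<Longrightarrow> 1 \<le> y x \<and> y x \<le> d x \<and> (x, y x) \<notin> E \<and> (x, y x) \<notin> E'" by metis
  let ?G = "(\<lambda>x. (x, y x)) ` X"
  let ?F = "T \<union> ?G"
  have finT: "finite T" using F0(2) D(1) by (rule finite_subset)
  have injT: "inj_on fst T" using D(3) F0(2) by (rule inj_on_subset)
  have finX: "finite X" using D(1) by (simp add: X_def)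
  have disj: "T \<inter> ?G = {}" by (force simp: X_def)
  have "card X = card (fst ` F0) - card (fst ` T)"
    unfolding X_def using F0(2) finT by (intro card_Diff_subset) auto
  also have "\<dots> = s - card T" using D(2,3) injT by (simp add: card_image)
  finally have "card X = s - card T" .
  moreover have "card T \<le> s" using card_mono[OF D(1) F0(2)] D(2) by simp
  moreover have "card ?G = card X" by (intro card_image) (simp add: inj_on_def)
  ultimately have "card ?F = s" using finT finX disj by (simp add: card_Un_disjoint)
  moreover have "inj_on fst ?F"
  proof -
    have "inj_on fst ?G" by (simp add: inj_on_def)
    moreover have "fst ` ?G = X" by force
    then have "fst ` (T - ?G) \<inter> fst ` (?G - T) = {}" unfolding X_def by blast
    ultimately show ?thesis using injT unfolding inj_on_Un by blast
  qed
  moreover have "\<forall>(x, z)\<in>?F. x \<in> {1..n} \<and> z \<in> {1..d x}"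
  proof -
    have "x \<in> {1..n} \<and> z \<in> {1..d x}" if "(x, z) \<in> T" for x z
      using that F0(2) D(4,5)[of x z] by auto
    moreover have "x \<in> {1..n} \<and> y x \<in> {1..d x}" if "x \<in> X" for x
      using that y[OF that] D(4) by (force simp: X_def)
    ultimately show ?thesis by blast
  qed
  moreover have "finite ?F" using finT finX by simp
  ultimately have "?F \<in> signed_sets n d s" unfolding signed_sets_iff by (intro conjI)
  moreover have "E \<inter> ?F = T" "E' \<inter> ?F = T" using E(3,4) y by blast+
  ultimately show ?thesis unfolding containing_def by blast
qed

text \<open>The members are obtained by choosing the remaining coordinates \<open>I\<close> and then a letter for each of
  them.\<close>

lemma card_signed_sets_fixed:
  assumes c: "IP_sequence n c" and t: "t \<le> r" "r \<le> n"
  shows "card (signed_sets_fixed n c r t) = (\<Sum>I\<in>nsets {t+1..n} (r - t). \<Prod>i\<in>I. c i)"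
proof -
  let ?N = "nsets {t+1..n} (r - t)"
  let ?D = "SIGMA I:?N. PiE I (\<lambda>i. {1..c i})"
  let ?f = "\<lambda>(I, y). (\<lambda>x. (x, 1 :: nat)) ` {1..t} \<union> (\<lambda>x. (x, y x)) ` I"
  have "bij_betw ?f ?D (signed_sets_fixed n c r t)"
    unfolding bij_betw_def
  proof
    show "inj_on ?f ?D"
    proof (rule inj_onI)
      fix u v assume u: "u \<in> ?D" and v: "v \<in> ?D" and e: "?f u = ?f v"
      obtain I y J z where uv: "u = (I, y)" "v = (J, z)" by fastforce
      have I: "I \<subseteq> {t+1..n}" "J \<subseteq> {t+1..n}" and y: "y \<in> PiE I (\<lambda>i. {1..c i})" "z \<in> PiE J (\<lambda>i. {1..c i})"
        using u v uv by (auto simp: nsets_def)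
      have e': "(\<lambda>x. (x, 1)) ` {1..t} \<union> (\<lambda>x. (x, y x)) ` I = (\<lambda>x. (x, 1)) ` {1..t} \<union> (\<lambda>x. (x, z x)) ` J"
        using e uv by simp
      have in_I: "(x, k) \<in> (\<lambda>x. (x, 1)) ` {1..t} \<union> (\<lambda>x. (x, w x)) ` K \<longleftrightarrow> x \<in> K \<and> k = w x"
        if "t < x" for x k K and w :: "nat \<Rightarrow> nat" using that by auto
      have iff: "(x \<in> I \<and> k = y x) \<longleftrightarrow> (x \<in> J \<and> k = z x)" if "t < x" for x k
        using in_I[OF that, of k y I] in_I[OF that, of k z J] unfolding e' by blast
      have IJ: "I = J"
      proof (rule set_eqI)
        fix x
        show "x \<in> I \<longleftrightarrow> x \<in> J"
        proof (cases "t < x")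
          case True
          then show ?thesis using iff by blast
        next
          case False
          then show ?thesis using I by auto
        qed
      qed
      have "y = z"
      proof (rule PiE_ext[OF y(1) y(2)[folded IJ]])
        fix x assume x: "x \<in> I"
        then have "t < x" using I by auto
        then show "y x = z x" using iff x by blast
      qed
      then show "u = v" using uv IJ by simp
    qed
    show "?f ` ?D = signed_sets_fixed n c r t"
    proof
      show "?f ` ?D \<subseteq> signed_sets_fixed n c r t"
      proof (rule image_subsetI)
        fix u assume u: "u \<in> ?D"
        obtain I y where uv: "u = (I, y)" by fastforce
        have I: "I \<subseteq> {t+1..n}" "finite I" "card I = r - t" and y: "y \<in> PiE I (\<lambda>i. {1..c i})"
          using u uv by (auto simp: nsets_def)
        let ?X = "{1..t} \<union> I" and ?y = "\<lambda>x. if x \<le> t then 1 else y x"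
        have disj: "{1..t} \<inter> I = {}" using I(1) by fastforce
        then have "card ?X = r" using I t by (simp add: card_Un_disjoint)
        then have "?X \<in> nsets {1..n} r" using I t unfolding nsets_def by fastforce
        moreover have "\<forall>x\<in>?X. ?y x \<in> {1..c x}"
          using y I(1) c t unfolding IP_sequence_def by (fastforce simp: PiE_iff Suc_le_eq)
        moreover have "?f u = (\<lambda>x. (x, ?y x)) ` ?X"
        proof -
          have "(\<lambda>x. (x, ?y x)) ` {1..t} = (\<lambda>x. (x, 1)) ` {1..t}" by (rule image_cong) auto
          moreover have "(\<lambda>x. (x, ?y x)) ` I = (\<lambda>x. (x, y x)) ` I" by (rule image_cong) (use I(1) in auto)
          ultimately show ?thesis using uv by (simp add: image_Un)
        qed
        ultimately have "?f u \<in> signed_sets n c r" unfolding signed_sets_def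
          by (intro CollectI exI[of _ ?X] exI[of _ ?y] conjI)
        moreover have "\<forall>x\<in>{1..t}. (x, 1) \<in> ?f u" using uv by simp
        ultimately show "?f u \<in> signed_sets_fixed n c r t" unfolding signed_sets_fixed_def by simp
      qed
      show "signed_sets_fixed n c r t \<subseteq> ?f ` ?D"
      proof
        fix A assume A: "A \<in> signed_sets_fixed n c r t"
        then obtain X y where X: "A = (\<lambda>x. (x, y x)) ` X" "X \<in> nsets {1..n} r" "\<forall>x\<in>X. y x \<in> {1..c x}"
          and one: "\<forall>x\<in>{1..t}. (x, 1) \<in> A" unfolding signed_sets_fixed_def signed_sets_def by blast
        have tX: "x \<in> X \<and> y x = 1" if "x \<in> {1..t}" for x
          using bspec[OF one that] unfolding X(1) in_graph_iff by simp
        let ?I = "X - {1..t}"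
        have "{1..t} \<subseteq> X" using tX by blast
        then have "card ?I = r - t" using X(2) by (subst card_Diff_subset) (auto simp: nsets_def)
        then have "?I \<in> ?N" using X(2) by (auto simp: nsets_def)
        moreover have "restrict y ?I \<in> PiE ?I (\<lambda>i. {1..c i})" using X(3) by auto
        moreover have "A = ?f (?I, restrict y ?I)"
        proof -
          have "X = {1..t} \<union> ?I" using tX by auto
          then have "A = (\<lambda>x. (x, y x)) ` {1..t} \<union> (\<lambda>x. (x, y x)) ` ?I" using X(1) image_Un by metis
          moreover have "(\<lambda>x. (x, y x)) ` {1..t} = (\<lambda>x. (x, 1)) ` {1..t}" by (rule image_cong) (use tX in auto)
          moreover have "(\<lambda>x. (x, restrict y ?I x)) ` ?I = (\<lambda>x. (x, y x)) ` ?I" by (rule image_cong) auto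
          ultimately show ?thesis by simp
        qed
        ultimately show "A \<in> ?f ` ?D" by blast
      qed
    qed
  qed
  then have "card (signed_sets_fixed n c r t) = card ?D" by (rule bij_betw_same_card[symmetric])
  also have "\<dots> = (\<Sum>I\<in>?N. card (PiE I (\<lambda>i. {1..c i})))"
    by (rule card_SigmaI) (auto simp: finite_imp_finite_nsets nsets_def intro!: finite_PiE)
  also have "\<dots> = (\<Sum>I\<in>?N. \<Prod>i\<in>I. c i)"
    by (rule sum.cong) (auto simp: card_PiE nsets_def)
  finally show ?thesis .
qed

section \<open>Cross-t-intersecting families of signed sets\<close>

text \<open>A member is counted by its set of ones. In the case of equality the families must consist of all signed sets
  whose ones lie in the extremal families of the weighted theorem.\<close>

lemma normalised_bound:
  assumes c: "IP_sequence m c" "lam + 1 \<le> real (c 1)" and d: "IP_sequence n d" "lam + 1 \<le> real (d 1)"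
    and t: "1 \<le> t" "real t \<le> lam" and lam: "2 * real t < 3 * (lam - 2)"
    and r: "t \<le> r" "r \<le> m" and s: "t \<le> s" "s \<le> n"
    and sub: "\<A> \<subseteq> signed_sets m c r" "\<B> \<subseteq> signed_sets n d s"
    and cross: "cross_intersecting t \<A> \<B>" and norm: "normalised \<A>"
  shows "card \<A> * card \<B> \<le> card (signed_sets_fixed m c r t) * card (signed_sets_fixed n d s t)"
    and "real t < lam \<Longrightarrow>
      card \<A> * card \<B> = card (signed_sets_fixed m c r t) * card (signed_sets_fixed n d s t) \<Longrightarrow>
      \<exists>T. finite T \<and> card T = t \<and> \<A> = containing (signed_sets m c r) T \<and> \<B> = containing (signed_sets n d s) T"
proof -
  let ?g = "ones_count m c r" and ?h = "ones_count n d s"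
  let ?X = "ones ` \<A>" and ?Y = "ones ` \<B>"
  let ?A = "{A \<in> signed_sets m c r. ones A \<in> ?X}" and ?B = "{B \<in> signed_sets n d s. ones B \<in> ?Y}"
  have lam2: "2 < lam" using lam t by simp
  have c2: "2 \<le> c 1" "2 \<le> d 1" using c d lam2 by simp_all
  have W: "shift_weight m lam ?g" by (rule shift_weight_ones_count[OF c lam2])
  have W': "shift_weight n lam ?h" by (rule shift_weight_ones_count[OF d lam2])
  have base: "0 < ?g {1..t}" "0 < ?h {1..t}"
    by (rule ones_count_base_pos[OF c(1) c2(1) r], rule ones_count_base_pos[OF d(1) c2(2) s])
  have fin: "finite \<A>" "finite \<B>" using sub finite_signed_sets finite_subset by metis+
  have pos: "?X \<subseteq> {X. 0 < ?g X}" "?Y \<subseteq> {X. 0 < ?h X}"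
    using sub iffD2[OF ones_count_pos_iff] by blast+
  have crossX: "cross_intersecting t ?X ?Y"
    unfolding cross_intersecting_def
    using normalised_ones_inter[OF norm cross sub] by blast
  note star = star_weight_ones_count[OF W, of t] star_weight_ones_count[OF W', of t]
  have sums: "sum ?g ?X = real (card ?A)" "sum ?h ?Y = real (card ?B)"
    by (rule sum_ones_count[OF finite_imageI[OF fin(1)]], rule sum_ones_count[OF finite_imageI[OF fin(2)]])
  have AA: "\<A> \<subseteq> ?A" and BB: "\<B> \<subseteq> ?B" using sub by blast+
  have le: "card \<A> \<le> card ?A" "card \<B> \<le> card ?B"
    by (rule card_mono[OF finite_signed_sets_Collect AA], rule card_mono[OF finite_signed_sets_Collect BB])
  have le_prod: "card \<A> * card \<B> \<le> card ?A * card ?B" using le by (rule mult_le_mono)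
  have "real (card ?A) * real (card ?B) \<le> real (card (signed_sets_fixed m c r t)) * real (card (signed_sets_fixed n d s t))"
    using weighted_cross_intersecting(1)[OF W W' t lam base pos crossX] unfolding sums star .
  then have bound: "card ?A * card ?B \<le> card (signed_sets_fixed m c r t) * card (signed_sets_fixed n d s t)"
    by (simp only: of_nat_mult[symmetric] of_nat_le_iff)
  then show "card \<A> * card \<B> \<le> card (signed_sets_fixed m c r t) * card (signed_sets_fixed n d s t)"
    using le_prod by linarith
  assume tl: "real t < lam"
    and eq: "card \<A> * card \<B> = card (signed_sets_fixed m c r t) * card (signed_sets_fixed n d s t)"
  have eq': "card ?A * card ?B = card (signed_sets_fixed m c r t) * card (signed_sets_fixed n d s t)"
    using bound le_prod eq by linarith
  then have "real (card ?A) * real (card ?B) = real (card (signed_sets_fixed m c r t)) * real (card (signed_sets_fixed n d s t))"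
    by (simp only: of_nat_mult[symmetric])
  then have "sum ?g ?X * sum ?h ?Y = shift_weight.star_weight ?g t * shift_weight.star_weight ?h t"
    unfolding sums star .
  from weighted_cross_intersecting(2)[OF W W' t lam base pos crossX tl this]
  obtain T where T: "finite T" "card T = t" "?X = containing {X. 0 < ?g X} T" "?Y = containing {X. 0 < ?h X} T"
    by blast
  have Fpos: "0 < card (signed_sets_fixed m c r t)" "0 < card (signed_sets_fixed n d s t)"
    by (rule card_signed_sets_fixed_pos[OF c(1) c2(1) r], rule card_signed_sets_fixed_pos[OF d(1) c2(2) s])
  then have "0 < card ?A * card ?B" using eq' by simp
  then have p: "0 < card ?A" "0 < card ?B" by simp_all
  have "card ?A * card ?B \<le> card \<A> * card \<B>" using eq eq' by simp
  note ge = two_product_eq[OF le zero_le zero_le p this]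
  have "card \<A> = card ?A" "card \<B> = card ?B"
    by (rule antisym[OF le(1) ge(1)], rule antisym[OF le(2) ge(2)])
  then have full: "\<A> = ?A" "\<B> = ?B"
    using card_subset_eq[OF finite_signed_sets_Collect AA] card_subset_eq[OF finite_signed_sets_Collect BB] by simp_all
  let ?T = "(\<lambda>x. (x, 1 :: nat)) ` T"
  have "?A = containing (signed_sets m c r) ?T"
    unfolding T(3) containing_def[of "signed_sets m c r"]
    by (rule Collect_cong, rule conj_cong[OF refl], rule ones_in_containing_iff)
  moreover have "?B = containing (signed_sets n d s) ?T"
    unfolding T(4) containing_def[of "signed_sets n d s"]
    by (rule Collect_cong, rule conj_cong[OF refl], rule ones_in_containing_iff)
  moreover have "finite ?T" "card ?T = t" using T by (simp_all add: card_image inj_on_def)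
  ultimately show "\<exists>T. finite T \<and> card T = t \<and> \<A> = containing (signed_sets m c r) T \<and> \<B> = containing (signed_sets n d s) T"
    using full by (intro exI[of _ ?T] conjI) simp_all
qed

lemma signed_sets_bound:
  assumes c: "IP_sequence m c" "lam + 1 \<le> real (c 1)" and d: "IP_sequence n d" "lam + 1 \<le> real (d 1)"
    and t: "1 \<le> t" "real t \<le> lam" and lam: "2 * real t < 3 * (lam - 2)"
    and r: "t \<le> r" "r \<le> m" and s: "t \<le> s" "s \<le> n"
  shows "\<A> \<subseteq> signed_sets m c r \<Longrightarrow> \<B> \<subseteq> signed_sets n d s \<Longrightarrow> cross_intersecting t \<A> \<B> \<Longrightarrow>
    card \<A> * card \<B> \<le> card (signed_sets_fixed m c r t) * card (signed_sets_fixed n d s t) \<and>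
    (real t < lam \<longrightarrow>
      card \<A> * card \<B> = card (signed_sets_fixed m c r t) * card (signed_sets_fixed n d s t) \<longrightarrow>
      (\<exists>T. finite T \<and> card T = t \<and> \<A> = containing (signed_sets m c r) T \<and> \<B> = containing (signed_sets n d s) T))"
proof (induction "total_rank snd \<A> + total_rank snd \<B>" arbitrary: \<A> \<B> rule: less_induct)
  case less
  note sub = less.prems(1,2) and cross = less.prems(3)
  have finA: "finite \<A>" "finite \<B>" using sub finite_signed_sets finite_subset by metis+
  have fin: "finite A" if "A \<in> \<A>" for A using signed_setsD(1) sub(1) that by blast
  have fin': "finite B" if "B \<in> \<B>" for B using signed_setsD(1) sub(2) that by blast
  show ?case
  proof (cases "normalised \<A>")
    case True
    show ?thesis
      using normalised_bound[OF c d t lam r s sub cross True] by blast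
  next
    case False
    then obtain A a b where b: "2 \<le> b" and A: "A \<in> \<A>" "shift (a, 1) (a, b) A \<notin> \<A>"
      unfolding normalised_def by blast
    let ?i = "(a, 1 :: nat)" and ?j = "(a, b)"
    have ij: "snd ?i < snd ?j" using b by simp
    have le': "total_rank snd (compress ?i ?j \<B>) \<le> total_rank snd \<B>"
      by (rule total_rank_compress(1)[where f = snd, OF finA(2) _ ij]) (rule fin')
    have "total_rank snd (compress ?i ?j \<A>) < total_rank snd \<A>"
      by (rule total_rank_compress(2)[where f = snd, OF finA(1) _ ij A]) (rule fin)
    then have lt: "total_rank snd (compress ?i ?j \<A>) + total_rank snd (compress ?i ?j \<B>) < total_rank snd \<A> + total_rank snd \<B>"
      using le' by simp
    have subc: "compress ?i ?j \<A> \<subseteq> signed_sets m c r" "compress ?i ?j \<B> \<subseteq> signed_sets n d s"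
      by (rule compress_subset[OF sub(1)], rule signed_shift[OF _ b], assumption,
          rule compress_subset[OF sub(2)], rule signed_shift[OF _ b], assumption)
    have crossc: "cross_intersecting t (compress ?i ?j \<A>) (compress ?i ?j \<B>)"
      by (rule cross_intersecting_compress[OF cross fin fin'])
    note IH = less.hyps[OF lt subc crossc, unfolded card_compress]
    have "\<exists>T. finite T \<and> card T = t \<and> \<A> = containing (signed_sets m c r) T \<and> \<B> = containing (signed_sets n d s) T"
      if tl: "real t < lam"
        and eq: "card \<A> * card \<B> = card (signed_sets_fixed m c r t) * card (signed_sets_fixed n d s t)"
    proof -
      obtain T where T: "finite T" "card T = t" "compress ?i ?j \<A> = containing (signed_sets m c r) T"
        "compress ?i ?j \<B> = containing (signed_sets n d s) T" using IH tl eq by blast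
      have c3: "3 \<le> c x" if "1 \<le> x" "x \<le> m" for x
      proof -
        have "2 < real (c 1)" using c(2) lam t by simp
        then show ?thesis using IP_sequence_ge[OF c(1) that] by simp
      qed
      have d3: "3 \<le> d x" if "1 \<le> x" "x \<le> n" for x
      proof -
        have "2 < real (d 1)" using d(2) lam t by simp
        then show ?thesis using IP_sequence_ge[OF d(1) that] by simp
      qed
      \<comment> \<open>A signed set has only one letter at each coordinate.\<close>
      have notj: "?j \<notin> F" if "F \<in> signed_sets k e q" "?i \<in> F" for F k e q
        using signed_setsD(6)[OF that] b by force
      have ne: "\<exists>F. F \<in> containing (signed_sets m c r) T" "\<exists>F. F \<in> containing (signed_sets n d s) T"
      proof -
        have "2 \<le> c 1" "2 \<le> d 1" using c(2) d(2) lam t by simp_all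
        then have "0 < card (signed_sets_fixed m c r t)" "0 < card (signed_sets_fixed n d s t)"
          using card_signed_sets_fixed_pos[OF c(1) _ r] card_signed_sets_fixed_pos[OF d(1) _ s] by blast+
        then have "card \<A> * card \<B> \<noteq> 0" using eq by simp
        then have "compress ?i ?j \<A> \<noteq> {}" "compress ?i ?j \<B> \<noteq> {}" by (auto simp: compress_def)
        then show "\<exists>F. F \<in> containing (signed_sets m c r) T" "\<exists>F. F \<in> containing (signed_sets n d s) T"
          unfolding T(3,4) by blast+
      qed
      have "\<exists>T'. finite T' \<and> card T' = card T \<and> \<A> = containing (signed_sets m c r) T' \<and> \<B> = containing (signed_sets n d s) T'"
      proof (rule containing_uncompress[OF T(3) sub(1) finite_signed_sets _ T(4) sub(2) finite_signed_sets])
        show "cross_intersecting (card T) \<A> \<B>" using cross T(2) by simp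
        show "finite T" by fact
        show "shift ?i ?j A \<in> signed_sets m c r" if "A \<in> signed_sets m c r" for A
          by (rule signed_shift[OF that b])
        show "shift ?i ?j B \<in> signed_sets n d s" if "B \<in> signed_sets n d s" for B
          by (rule signed_shift[OF that b])
        show "\<exists>F\<in>containing (signed_sets n d s) T. E \<inter> F = T \<and> E' \<inter> F = T \<and> (?i \<in> T \<longrightarrow> ?j \<notin> F)"
          if "E \<in> containing (signed_sets m c r) T" "E' \<in> containing (signed_sets m c r) T" for E E'
        proof -
          obtain F0 where F0: "F0 \<in> signed_sets n d s" "T \<subseteq> F0" using ne(2) by (auto simp: containing_def)
          have E: "E \<in> signed_sets m c r" "E' \<in> signed_sets m c r" "T \<subseteq> E" "T \<subseteq> E'"
            using that by (simp_all add: containing_def)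
          obtain F where F: "F \<in> signed_sets n d s" "T \<subseteq> F" "E \<inter> F = T" "E' \<inter> F = T"
            using avoiding_extension[OF F0 d3 E] by (auto simp: containing_def)
          have "?i \<in> T \<longrightarrow> ?j \<notin> F" using notj[OF F(1)] F(2) by blast
          then show ?thesis using F by (intro bexI[of _ F] conjI) (simp_all add: containing_def)
        qed
        show "\<exists>E\<in>containing (signed_sets m c r) T. F \<inter> E = T \<and> F' \<inter> E = T \<and> (?i \<in> T \<longrightarrow> ?j \<notin> E)"
          if "F \<in> containing (signed_sets n d s) T" "F' \<in> containing (signed_sets n d s) T" for F F'
        proof -
          obtain E0 where E0: "E0 \<in> signed_sets m c r" "T \<subseteq> E0" using ne(1) by (auto simp: containing_def)
          have F: "F \<in> signed_sets n d s" "F' \<in> signed_sets n d s" "T \<subseteq> F" "T \<subseteq> F'"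
            using that by (simp_all add: containing_def)
          obtain E where E: "E \<in> signed_sets m c r" "T \<subseteq> E" "F \<inter> E = T" "F' \<inter> E = T"
            using avoiding_extension[OF E0 c3 F] by (auto simp: containing_def)
          have "?i \<in> T \<longrightarrow> ?j \<notin> E" using notj[OF E(1)] E(2) by blast
          then show ?thesis using E by (intro bexI[of _ E] conjI) (simp_all add: containing_def)
        qed
      qed
      then show ?thesis unfolding T(2) .
    qed
    then show ?thesis using IH by blast
  qed
qed

theorem theorem1p5:
  fixes m n r s t :: nat
    and c d :: "nat \<Rightarrow> nat"
    and u :: real
    and \<A> \<B> :: "(nat \<times> nat) set set"
  assumes "IP_sequence m c" and "IP_sequence n d"
    and "r \<in> {1..m}" and "s \<in> {1..n}" and "t \<in> {1..min r s}"
    and "u \<ge> 0" and "u > (6 - real t) / 3"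
    and "real (c 1) \<ge> real t + u + 1" and "real (d 1) \<ge> real t + u + 1"
    and "\<A> \<subseteq> signed_sets m c r" and "\<B> \<subseteq> signed_sets n d s"
    and "cross_intersecting t \<A> \<B>"
  shows "card \<A> * card \<B> \<le>
           (\<Sum>I\<in>nsets {t+1..m} (r - t). \<Prod>i\<in>I. c i) * (\<Sum>J\<in>nsets {t+1..n} (s - t). \<Prod>j\<in>J. d j)
       \<and> (u > 0 \<longrightarrow>
           (card \<A> * card \<B> =
              (\<Sum>I\<in>nsets {t+1..m} (r - t). \<Prod>i\<in>I. c i) * (\<Sum>J\<in>nsets {t+1..n} (s - t). \<Prod>j\<in>J. d j)
            \<longleftrightarrow>
            (\<exists>T\<in>signed_sets m c t \<inter> signed_sets n d t.
               card (containing (signed_sets m c r) T) = card (signed_sets_fixed m c r t) \<and>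
               card (containing (signed_sets n d s) T) = card (signed_sets_fixed n d s t) \<and>
               \<A> = containing (signed_sets m c r) T \<and>
               \<B> = containing (signed_sets n d s) T)))"
proof -
  define lam where "lam = real t + u"
  have t: "1 \<le> t" "real t \<le> lam" and lam: "2 * real t < 3 * (lam - 2)"
    and r: "t \<le> r" "r \<le> m" and s: "t \<le> s" "s \<le> n"
    using assms(3-7) by (simp_all add: lam_def field_simps)
  have c: "IP_sequence m c" "lam + 1 \<le> real (c 1)" and d: "IP_sequence n d" "lam + 1 \<le> real (d 1)"
    using assms(1,2,8,9) by (simp_all add: lam_def)
  have tl: "real t < lam \<longleftrightarrow> 0 < u" by (simp add: lam_def)
  let ?F = "card (signed_sets_fixed m c r t)" and ?G = "card (signed_sets_fixed n d s t)"
  have FG: "(\<Sum>I\<in>nsets {t+1..m} (r - t). \<Prod>i\<in>I. c i) = ?F" "(\<Sum>J\<in>nsets {t+1..n} (s - t). \<Prod>j\<in>J. d j) = ?G"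
    using card_signed_sets_fixed[OF c(1) r] card_signed_sets_fixed[OF d(1) s] by simp_all
  have main: "card \<A> * card \<B> \<le> ?F * ?G"
    "real t < lam \<Longrightarrow> card \<A> * card \<B> = ?F * ?G \<Longrightarrow>
      \<exists>T. finite T \<and> card T = t \<and> \<A> = containing (signed_sets m c r) T \<and> \<B> = containing (signed_sets n d s) T"
    using signed_sets_bound[OF c d t lam r s assms(10-12)] by blast+
  \<comment> \<open>The bound for the pair of two equal families, a star against itself, shows that no star of a
    \<open>t\<close>-set is larger than the family of signed sets with ones on \<open>{1..t}\<close>.\<close>
  have star_le: "card (containing (signed_sets k e q) T) \<le> card (signed_sets_fixed k e q t)"
    if e: "IP_sequence k e" "lam + 1 \<le> real (e 1)" and q: "t \<le> q" "q \<le> k" and T: "card T = t" for k e q T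
  proof -
    let ?C = "containing (signed_sets k e q) T"
    have "cross_intersecting t ?C ?C"
      by (rule cross_intersecting_containing[OF T signed_setsD(1)])
    moreover have "?C \<subseteq> signed_sets k e q" by (auto simp: containing_def)
    ultimately have "card ?C * card ?C \<le> card (signed_sets_fixed k e q t) * card (signed_sets_fixed k e q t)"
      using signed_sets_bound[OF e e t lam q q, of ?C ?C] by blast
    then have "(card ?C)\<^sup>2 \<le> (card (signed_sets_fixed k e q t))\<^sup>2" by (simp only: power2_eq_square)
    then show ?thesis by (rule power2_le_imp_le) simp
  qed
  have "\<exists>T\<in>signed_sets m c t \<inter> signed_sets n d t.
      card (containing (signed_sets m c r) T) = ?F \<and> card (containing (signed_sets n d s) T) = ?G \<and>
      \<A> = containing (signed_sets m c r) T \<and> \<B> = containing (signed_sets n d s) T"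
    if u: "0 < u" and eq: "card \<A> * card \<B> = ?F * ?G"
  proof -
    obtain T where T: "finite T" "card T = t" "\<A> = containing (signed_sets m c r) T" "\<B> = containing (signed_sets n d s) T"
      using main(2) tl u eq by blast
    have le: "card \<A> \<le> ?F" "card \<B> \<le> ?G"
      unfolding T(3,4) by (rule star_le[OF c r T(2)], rule star_le[OF d s T(2)])
    have "2 \<le> c 1" "2 \<le> d 1" using c(2) d(2) lam t by simp_all
    then have pos: "0 < ?F" "0 < ?G"
      using card_signed_sets_fixed_pos[OF c(1) _ r] card_signed_sets_fixed_pos[OF d(1) _ s] by blast+
    have eqs: "card \<A> = ?F" "card \<B> = ?G"
    proof -
      have "?F * ?G \<le> card \<A> * card \<B>" using eq by simp
      note ge = two_product_eq[OF le zero_le zero_le pos this]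
      show "card \<A> = ?F" "card \<B> = ?G" by (rule antisym[OF le(1) ge(1)], rule antisym[OF le(2) ge(2)])
    qed
    have "\<A> \<noteq> {}" "\<B> \<noteq> {}" using eqs pos by auto
    then obtain A B where "A \<in> signed_sets m c r" "T \<subseteq> A" "B \<in> signed_sets n d s" "T \<subseteq> B"
      unfolding T(3,4) containing_def by blast
    then have "T \<in> signed_sets m c t" "T \<in> signed_sets n d t"
      using signed_sets_subset T(2) by blast+
    then show ?thesis using T(3,4) eqs by (intro bexI[of _ T] conjI) simp_all
  qed
  moreover have "card \<A> * card \<B> = ?F * ?G"
    if "\<exists>T\<in>signed_sets m c t \<inter> signed_sets n d t.
      card (containing (signed_sets m c r) T) = ?F \<and> card (containing (signed_sets n d s) T) = ?G \<and>
      \<A> = containing (signed_sets m c r) T \<and> \<B> = containing (signed_sets n d s) T"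
    using that by auto
  ultimately show ?thesis using main(1) unfolding FG by blast
qed

end
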